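(* Let $\alpha>0$ and let $\psi,\varphi:\mathbb C\to\mathbb C$ be entire functions. The following are equivalent. (i) There exists $f\in L^\infty(\mathbb C,dA)$ such that $W_{\psi,\varphi}=T_f$ on $F^2_\alpha$. (ii) Either $\psi\equiv 0$, or there exist $a,\lambda\in\mathbb C$ such that $\varphi(z)=a+\lambda z$, $\lambda\neq 0$, and $$\operatorname{Re}\lambda\ge|\lambda|^2,$$ and $$\sup_{z\in\mathbb C}|\psi(z)|\exp\!\Bigl[\alpha\bigl(-(\operatorname{Re}\lambda-|\lambda|^2)|z|^2+\operatorname{Re}((2\lambda-1)\bar a z)\bigr)\Bigr]<\infty.$$ Moreover, in the nonzero case $\psi\not\equiv 0$, the bounded Toeplitz symbol is unique and equals $f=F_{\psi,a,\lambda}$ a.e., where $$F_{\psi,a,\lambda}(w)=\frac1\lambda\exp\!\Bigl[\alpha\Bigl(\frac{\lambda-1}{\lambda}|w|^2+\frac a\lambda\bar w\Bigr)\Bigr]\psi\!\Bigl(\frac{w-a}{\lambda}\Bigr).$$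
   Context: Fix $\alpha>0$. Let $dA$ denote Lebesgue area measure on $\mathbb C$, $d\lambda_\alpha(z)=\frac{\alpha}{\pi}e^{-\alpha|z|^2}dA(z)$, and let $F^2_\alpha$ be the Fock space of all entire functions in $L^2(\mathbb C,d\lambda_\alpha)$. For $f\in L^\infty(\mathbb C,dA)$ the Toeplitz operator $T_f$ on $F^2_\alpha$ is the bounded operator $$T_fh(z)=\frac{\alpha}{\pi}\int_{\mathbb C}f(u)h(u)e^{\alpha z\bar u-\alpha|u|^2}\,dA(u).$$ The weighted composition operator is $W_{\psi,\varphi}h=\psi\cdot(h\circ\varphi)$. The statement "$W_{\psi,\varphi}=T_f$ on $F^2_\alpha$" means $W_{\psi,\varphi}h=T_fh$ for every $h\in F^2_\alpha$. *)

theory Defs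
  imports "HOL-Complex_Analysis.Complex_Analysis"
begin

definition fock_measure :: "real \<Rightarrow> complex measure" where
  "fock_measure \<alpha> =
     density lebesgue (\<lambda>z. ennreal (\<alpha> / pi * exp (- \<alpha> * (cmod z)\<^sup>2)))"

definition fock_space :: "real \<Rightarrow> (complex \<Rightarrow> complex) set" where
  "fock_space \<alpha> =
     {h. h holomorphic_on UNIV \<and> integrable (fock_measure \<alpha>) (\<lambda>z. (cmod (h z))\<^sup>2)}"

text \<open>Elements are functions, not classes modulo null sets; equality of symbols is therefore
  always stated almost everywhere.\<close>
definition Linfty :: "(complex \<Rightarrow> complex) set" where
  "Linfty = {f \<in> borel_measurable lebesgue. \<exists>C. AE z in lebesgue. cmod (f z) \<le> C}"

definition toeplitz ::
    "real \<Rightarrow> (complex \<Rightarrow> complex) \<Rightarrow> (complex \<Rightarrow> complex) \<Rightarrow> complex \<Rightarrow> complex" where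
  "toeplitz \<alpha> f h z = of_real (\<alpha> / pi) *
     (LINT u|lebesgue. f u * h u *
        exp (of_real \<alpha> * z * cnj u - of_real \<alpha> * of_real ((cmod u)\<^sup>2)))"

definition weighted_comp ::
    "(complex \<Rightarrow> complex) \<Rightarrow> (complex \<Rightarrow> complex) \<Rightarrow> (complex \<Rightarrow> complex) \<Rightarrow> complex \<Rightarrow> complex" where
  "weighted_comp \<psi> \<phi> h = (\<lambda>z. \<psi> z * h (\<phi> z))"

definition weighted_comp_eq_toeplitz ::
    "real \<Rightarrow> (complex \<Rightarrow> complex) \<Rightarrow> (complex \<Rightarrow> complex) \<Rightarrow> (complex \<Rightarrow> complex) \<Rightarrow> bool" where
  "weighted_comp_eq_toeplitz \<alpha> \<psi> \<phi> f \<longleftrightarrow>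
     (\<forall>h \<in> fock_space \<alpha>. weighted_comp \<psi> \<phi> h = toeplitz \<alpha> f h)"

text \<open>The slope \<open>\<mu>\<close> of \<open>\<phi>\<close> is usually written \<open>\<lambda>\<close>, which is reserved for abstraction here.\<close>
definition affine_growth_cond ::
    "real \<Rightarrow> (complex \<Rightarrow> complex) \<Rightarrow> (complex \<Rightarrow> complex) \<Rightarrow> complex \<Rightarrow> complex \<Rightarrow> bool" where
  "affine_growth_cond \<alpha> \<psi> \<phi> a \<mu> \<longleftrightarrow>
     (\<forall>z. \<phi> z = a + \<mu> * z) \<and> \<mu> \<noteq> 0 \<and> Re \<mu> \<ge> (cmod \<mu>)\<^sup>2 \<and>
     bdd_above (range (\<lambda>z. cmod (\<psi> z) *
       exp (\<alpha> * (- (Re \<mu> - (cmod \<mu>)\<^sup>2) * (cmod z)\<^sup>2 + Re ((2 * \<mu> - 1) * cnj a * z)))))"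

definition toeplitz_symbol ::
    "real \<Rightarrow> (complex \<Rightarrow> complex) \<Rightarrow> complex \<Rightarrow> complex \<Rightarrow> complex \<Rightarrow> complex" where
  "toeplitz_symbol \<alpha> \<psi> a \<mu> w =
     1 / \<mu> * exp (of_real \<alpha> * ((\<mu> - 1) / \<mu> * of_real ((cmod w)\<^sup>2) + a / \<mu> * cnj w)) *
     \<psi> ((w - a) / \<mu>)"

end

theory Submission
  imports Defs
begin

text \<open>
  Both operators are compared on the reproducing kernels \<open>K\<^sub>w(u) = exp (\<alpha> u cnj w)\<close>.  On these,
  \<open>T\<^sub>f K\<^sub>w (z)\<close> is the integral of \<open>f\<close> against the exponential of a quadratic polynomial, and
  integrating the modulus of that exponential exactly gives
  \<open>\<bar>T\<^sub>f K\<^sub>w (z)\<bar> \<le> \<parallel>f\<parallel> exp (\<alpha> \<bar>z + w\<bar>\<^sup>2 / 4)\<close>.  If \<open>T\<^sub>f\<close> is the weighted composition operator, this reads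
  \<open>\<bar>\<psi> z\<bar> exp (\<alpha> Re (\<phi> z cnj w)) \<le> M exp (\<alpha> \<bar>z + w\<bar>\<^sup>2 / 4)\<close> for all \<open>z\<close> and \<open>w\<close>,
  and every necessary condition comes from choosing \<open>w\<close> well as a function of \<open>z\<close>.

  \<^item> To see that \<open>\<phi>\<close> is affine, move a point where \<open>\<psi> \<noteq> 0\<close> to the origin and let \<open>c\<^sub>n\<close> be the Taylor
    coefficients of \<open>\<phi>\<close>.  On the circle \<open>\<bar>z\<bar> = r\<close> take \<open>w = 2 c\<^sub>n z ^ n - z\<close>.  Then \<open>\<bar>z + w\<bar>\<close> is constant, and
    since \<open>cnj z = r\<^sup>2 / z\<close> on the circle, \<open>Re (\<phi> z cnj w)\<close> is the real part of an entire function.  The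
    maximum principle for \<open>\<psi>\<close> times an exponential therefore yields
    \<open>\<bar>\<psi> 0\<bar> exp (\<alpha> (\<bar>c\<^sub>n\<bar>\<^sup>2 r ^ (2 n) - r\<^sup>2 Re c\<^sub>1)) \<le> M\<close> for every \<open>r\<close>
    (\<open>taylor_coeff_bound\<close>).  Letting \<open>r\<close> grow gives \<open>c\<^sub>n = 0\<close> for \<open>n \<ge> 2\<close> and
    \<open>\<bar>c\<^sub>1\<bar>\<^sup>2 \<le> Re c\<^sub>1\<close>.
  \<^item> The choice \<open>w = 2 \<phi> z - z\<close> optimises the inequality for each \<open>z\<close> and is the growth condition on \<open>\<psi>\<close>
    (\<open>growth_at_optimal_point\<close>).
  \<^item> If \<open>\<phi>\<close> were a constant \<open>a\<close>, the growth bound and Liouville's theorem would give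
    \<open>\<psi> z = c exp (\<alpha> cnj a z)\<close>, so the integrable function \<open>f u exp (- \<alpha> \<bar>u\<bar>\<^sup>2)\<close> would have the Fourier
    transform of a multiple of the point mass at \<open>a\<close>.  Testing with concentrating Gaussians gives \<open>c = 0\<close>.

  For the converse, the growth condition says exactly that the proposed symbol is bounded.  The
  substitution \<open>u = a + \<mu> (z + \<zeta>)\<close> turns the Toeplitz integral into
  \<open>\<integral> G \<zeta> exp (- \<alpha> cnj \<mu> \<bar>\<zeta>\<bar>\<^sup>2)\<close> with \<open>G\<close> entire.  Averaging over rotations replaces \<open>G\<close> by \<open>G 0\<close>
  (\<open>integral_entire_mult_radial\<close>), which is the value of the weighted composition operator up to a
  Gaussian integral that converges because \<open>Re \<mu> \<ge> \<bar>\<mu>\<bar>\<^sup>2 > 0\<close>.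

  Uniqueness holds because the values of \<open>T\<^sub>f\<close> on kernels contain the Fourier transform of
  \<open>f u exp (- \<alpha> \<bar>u\<bar>\<^sup>2)\<close>, and the Fourier transform is injective on integrable functions
  (\<open>fourier_zero_imp_AE_zero\<close>).
\<close>

unbundle no fps_syntax

section \<open>Affine changes of variable in the plane\<close>

text \<open>Linear maps of \<open>real^2\<close> scale area by their determinant; this identification carries the fact over
  to the complex plane.\<close>
lemma lborel_complex_eq_distr_vec:
  "lborel = distr (lborel :: (real^2) measure) borel (\<lambda>v. Complex (v$1) (v$2))"
proof (rule lborel_eqI)
  let ?T = "\<lambda>v::real^2. Complex (v$1) (v$2)"
  have T[measurable]: "?T \<in> borel_measurable borel"
    by (intro borel_measurable_continuous_onI) (auto simp: Complex_eq intro!: continuous_intros)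
  fix l u :: complex
  assume lu: "\<And>b. b \<in> Basis \<Longrightarrow> l \<bullet> b \<le> u \<bullet> b"
  have le: "Re l \<le> Re u" "Im l \<le> Im u"
    using lu[of 1] lu[of \<i>] by (auto simp: Basis_complex_def inner_complex_def)
  define a b :: "real^2" where "a = vector [Re l, Im l]" and "b = vector [Re u, Im u]"
  have pre: "?T -` box l u \<inter> space lborel = box a b"
    by (auto simp: mem_box_cart in_box_complex_iff forall_2 a_def b_def)
  have ab: "\<forall>i. a$i \<le> b$i" using le by (auto simp: forall_2 a_def b_def)
  then have ne: "cbox a b \<noteq> {}" by (auto simp: interval_ne_empty_cart)
  have "emeasure (distr lborel borel ?T) (box l u) = emeasure lborel (box a b)"
    by (subst emeasure_distr) (use pre in auto)
  also have "\<dots> = emeasure lborel (cbox a b)"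
    by (simp add: emeasure_lborel_box_eq emeasure_lborel_cbox_eq)
  also have "\<dots> = ennreal (measure lborel (cbox a b))"
    by (rule emeasure_eq_ennreal_measure) (auto simp: emeasure_lborel_cbox_eq)
  also have "measure lborel (cbox a b) = (Re u - Re l) * (Im u - Im l)"
    using content_cbox_cart[OF ne] by (simp add: UNIV_2 a_def b_def)
  also have "\<dots> = (\<Prod>b\<in>Basis. (u - l) \<bullet> b)"
    by (simp add: Basis_complex_def inner_complex_def)
  finally show "emeasure (distr lborel borel ?T) (box l u) = ennreal (\<Prod>b\<in>Basis. (u - l) \<bullet> b)" .
qed simp

text \<open>Multiplication by \<open>\<mu>\<close> is a real linear map of determinant \<open>\<bar>\<mu>\<bar>\<^sup>2\<close>.  The case \<open>\<bar>\<mu>\<bar> = 1\<close> is the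
  rotation invariance of area on which the mean value property below rests.\<close>
lemma lborel_distr_complex_mult:
  fixes \<mu> :: complex
  assumes "\<mu> \<noteq> 0"
  shows "lborel = density (distr lborel borel ((*) \<mu>)) (\<lambda>_. ennreal ((cmod \<mu>)\<^sup>2))"
proof (rule lborel_eqI)
  let ?T = "\<lambda>v::real^2. Complex (v$1) (v$2)"
  have T[measurable]: "?T \<in> borel_measurable borel"
    by (intro borel_measurable_continuous_onI) (auto simp: Complex_eq intro!: continuous_intros)
  define \<nu> where "\<nu> = inverse \<mu>"
  define f :: "real^2 \<Rightarrow> real^2" where
    "f v = vector [Re \<nu> * v$1 - Im \<nu> * v$2, Im \<nu> * v$1 + Re \<nu> * v$2]" for v
  have Tf: "?T (f v) = \<nu> * ?T v" for v
    by (simp add: f_def complex_eq_iff)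
  have Tinj: "?T v = ?T w \<longleftrightarrow> v = w" for v w
    by (simp add: vec_eq_iff forall_2)
  have lin: "linear f"
    by (rule linearI) (auto simp: f_def vec_eq_iff forall_2 algebra_simps)
  have det: "det (matrix f) = (cmod \<nu>)\<^sup>2"
    by (simp add: det_2 matrix_def f_def axis_def cmod_power2 flip: power2_eq_square)
  have \<mu>\<nu>: "\<mu> * (\<nu> * z) = z" "\<nu> * (\<mu> * z) = z" for z using assms by (auto simp: \<nu>_def)
  fix l u :: complex
  assume lu: "\<And>b. b \<in> Basis \<Longrightarrow> l \<bullet> b \<le> u \<bullet> b"
  define S where "S = ?T -` box l u"
  have S: "S \<in> sets borel" unfolding S_def by (rule measurable_sets_borel[OF T]) auto
  have eS: "emeasure lborel S = emeasure lborel (box l u)"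
    using arg_cong[where f = "\<lambda>M. emeasure M (box l u)", OF lborel_complex_eq_distr_vec]
    by (subst (asm) emeasure_distr) (auto simp: S_def)
  have Sm: "S \<in> lmeasurable"
    by (rule fmeasurableI) (use S eS in \<open>auto simp: emeasure_lborel_box_eq\<close>)
  have pre: "?T -` ((*) \<mu> -` box l u) = f ` S"
  proof safe
    fix v assume *: "\<mu> * ?T v \<in> box l u"
    define w :: "real^2" where "w = vector [Re (\<mu> * ?T v), Im (\<mu> * ?T v)]"
    have w: "?T w = \<mu> * ?T v" by (simp add: w_def complex_eq_iff)
    then have "?T (f w) = ?T v" unfolding Tf w by (simp add: \<mu>\<nu>)
    then have "f w = v" by (simp only: Tinj)
    moreover have "w \<in> S" using * w by (simp add: S_def)
    ultimately show "v \<in> f ` S" by blast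
  next
    fix v assume "v \<in> S"
    then show "f v \<in> ?T -` ((*) \<mu> -` box l u)"
      by (simp add: Tf \<mu>\<nu> S_def)
  qed
  have m[measurable]: "(*) \<mu> \<in> borel_measurable borel"
    by simp
  have B0[measurable]: "(*) \<mu> -` box l u \<in> sets borel"
    by (rule measurable_sets_borel[OF m]) auto
  have B: "f ` S \<in> sets borel" unfolding pre[symmetric]
    by (rule measurable_sets_borel[OF T B0])
  have "emeasure (distr lborel borel ((*) \<mu>)) (box l u) = emeasure lborel ((*) \<mu> -` box l u)"
    by (subst emeasure_distr) auto
  also have "\<dots> = emeasure lborel (f ` S)"
    by (subst lborel_complex_eq_distr_vec, subst emeasure_distr)
       (auto simp: pre[symmetric])
  also have "\<dots> = emeasure lebesgue (f ` S)"
    using B by simp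
  also have "\<dots> = ennreal (measure lebesgue (f ` S))"
    using measurable_linear_image[OF lin Sm] by (simp add: emeasure_eq_measure2)
  also have "measure lebesgue (f ` S) = (cmod \<nu>)\<^sup>2 * measure lebesgue S"
    using measure_linear_image[OF lin Sm] by (simp add: det)
  also have "ennreal \<dots> = ennreal ((cmod \<nu>)\<^sup>2) * emeasure lborel (box l u)"
  proof -
    have "emeasure lborel S = ennreal (measure lborel S)"
      by (rule emeasure_eq_ennreal_measure) (simp add: eS emeasure_lborel_box_eq)
    then show ?thesis using S eS by (simp add: ennreal_mult)
  qed
  finally have "emeasure (density (distr lborel borel ((*) \<mu>)) (\<lambda>_. ennreal ((cmod \<mu>)\<^sup>2))) (box l u)
      = ennreal ((cmod \<mu>)\<^sup>2) * (ennreal ((cmod \<nu>)\<^sup>2) * emeasure lborel (box l u))"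
    by (subst emeasure_density) (auto simp: nn_integral_cmult_indicator)
  also have "\<dots> = emeasure lborel (box l u)"
  proof -
    have "(cmod \<mu>)\<^sup>2 * (cmod \<nu>)\<^sup>2 = 1"
      using assms by (simp add: \<nu>_def norm_inverse flip: power_mult_distrib)
    then have "ennreal ((cmod \<mu>)\<^sup>2) * ennreal ((cmod \<nu>)\<^sup>2) = 1"
      by (subst ennreal_mult[symmetric]) auto
    then show ?thesis by (metis mult.assoc mult_1)
  qed
  also have "\<dots> = (\<Prod>b\<in>Basis. (u - l) \<bullet> b)"
    using lu by (rule emeasure_lborel_box)
  finally show "emeasure (density (distr lborel borel ((*) \<mu>)) (\<lambda>_. ennreal ((cmod \<mu>)\<^sup>2))) (box l u)
      = ennreal (\<Prod>b\<in>Basis. (u - l) \<bullet> b)" .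
qed simp

lemma nn_integral_lborel_complex_affine:
  fixes \<mu> a :: complex
  assumes "\<mu> \<noteq> 0" and [measurable]: "f \<in> borel_measurable borel"
  shows "(\<integral>\<^sup>+z. f z \<partial>lborel) = ennreal ((cmod \<mu>)\<^sup>2) * (\<integral>\<^sup>+z. f (a + \<mu> * z) \<partial>lborel)"
proof -
  have "(\<integral>\<^sup>+z. f z \<partial>lborel) = (\<integral>\<^sup>+z. f (a + z) \<partial>lborel)"
    by (subst lborel_distr_plus[of a, symmetric], subst nn_integral_distr) auto
  also have "\<dots> = ennreal ((cmod \<mu>)\<^sup>2) * (\<integral>\<^sup>+z. f (a + \<mu> * z) \<partial>lborel)"
    by (subst lborel_distr_complex_mult[OF assms(1)])
       (simp add: nn_integral_density nn_integral_distr nn_integral_cmult)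
  finally show ?thesis .
qed

lemma lborel_complex_integrable_affine_iff:
  fixes \<mu> a :: complex and f :: "complex \<Rightarrow> 'b::{banach, second_countable_topology}"
  assumes "\<mu> \<noteq> 0"
  shows "integrable lborel (\<lambda>z. f (a + \<mu> * z)) \<longleftrightarrow> integrable lborel f"
proof -
  have *: "integrable lborel (\<lambda>z. f (a + \<mu> * z))" if "integrable lborel f" "\<mu> \<noteq> 0"
    for f :: "complex \<Rightarrow> 'b" and \<mu> a :: complex
  proof -
    have [measurable]: "f \<in> borel_measurable borel" using that by auto
    have "(\<integral>\<^sup>+z. norm (f z) \<partial>lborel) < \<infinity>" using that by (simp add: integrable_iff_bounded)
    then show ?thesis
      using that nn_integral_lborel_complex_affine[of \<mu> "\<lambda>z. norm (f z)" a]
      by (auto simp: integrable_iff_bounded ennreal_mult_less_top)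
  qed
  from *[of f \<mu> a] *[of "\<lambda>z. f (a + \<mu> * z)" "1/\<mu>" "-a/\<mu>"] assms show ?thesis
    by (auto simp: field_simps)
qed

lemma lborel_complex_integral_affine:
  fixes \<mu> a :: complex and f :: "complex \<Rightarrow> 'b::{banach, second_countable_topology}"
  assumes "\<mu> \<noteq> 0"
  shows "(LINT z|lborel. f z) = (cmod \<mu>)\<^sup>2 *\<^sub>R (LINT z|lborel. f (a + \<mu> * z))"
proof (cases "integrable lborel f")
  case True
  then have [measurable]: "f \<in> borel_measurable borel" by auto
  have "(LINT z|lborel. f z) = (LINT z|lborel. f (a + z))"
    by (subst lborel_distr_plus[of a, symmetric], subst integral_distr) auto
  also have "\<dots> = (cmod \<mu>)\<^sup>2 *\<^sub>R (LINT z|lborel. f (a + \<mu> * z))"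
    by (subst lborel_distr_complex_mult[OF assms(1)])
       (simp add: integral_density integral_distr)
  finally show ?thesis .
next
  case False
  then show ?thesis using lborel_complex_integrable_affine_iff[OF assms, of f a]
    by (simp add: not_integrable_integral_eq)
qed

section \<open>Radial integrals and the mean value property\<close>

text \<open>A disc of radius \<open>sqrt t\<close> has area \<open>pi t\<close>.  This replaces polar coordinates: it reduces the
  integral of a function of \<open>\<bar>z\<bar>\<^sup>2\<close>, with complex values allowed, to one over the half line.\<close>
lemma distr_lborel_cmod_power2:
  "distr lborel borel (\<lambda>z. (cmod z)\<^sup>2) = density lborel (\<lambda>t::real. ennreal (pi * indicator {0..} t))"
    (is "?L = ?R")
proof (rule measure_eqI_generator_eq[where E = "range atMost" and \<Omega> = UNIV and A = "\<lambda>n::nat. {..real n}"])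
  show "Int_stable (range atMost :: real set set)" by (auto simp: Int_stable_def)
  show "sets ?L = sigma_sets UNIV (range atMost)" "sets ?R = sigma_sets UNIV (range atMost)"
    by (simp_all add: borel_eq_atMost)
  show "(\<Union>n. {..real n}) = UNIV" by (auto simp: real_arch_simple)
  have L: "emeasure ?L {..t} = (if t < 0 then 0 else ennreal (pi * t))" for t
  proof -
    have "(cmod z)\<^sup>2 \<le> t \<longleftrightarrow> 0 \<le> t \<and> cmod z \<le> sqrt t" for z
      using power2_le_iff_abs_le[of "sqrt t" "cmod z"] order.trans[OF zero_le_power2[of "cmod z"], of t]
      by (cases "0 \<le> t") auto
    then have "(\<lambda>z. (cmod z)\<^sup>2) -` {..t} = (if t < 0 then {} else cball 0 (sqrt t))"
      by (auto simp: not_less)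
    then show ?thesis
      by (subst emeasure_distr) (auto simp: emeasure_cball unit_ball_vol_2)
  qed
  show "emeasure ?L X = emeasure ?R X" if "X \<in> range atMost" for X
  proof -
    from that obtain t where X: "X = {..t}" by auto
    have "emeasure ?R {..t} = (\<integral>\<^sup>+x. ennreal pi * indicator {0..t} x \<partial>lborel)"
      by (subst emeasure_density) (auto intro!: nn_integral_cong simp: indicator_def)
    also have "\<dots> = ennreal pi * emeasure lborel {0..t}"
      by (subst nn_integral_cmult_indicator) auto
    finally show ?thesis unfolding X L by (auto simp: ennreal_mult)
  qed
  show "emeasure ?L {..real n} \<noteq> \<infinity>" for n unfolding L by auto
qed auto

lemma exp_minus_mult_integral:
  fixes c :: complex
  assumes "Re c > 0"
  shows "set_integrable lborel {0..} (\<lambda>t::real. exp (- c * of_real t))"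
    and "(LINT t:{0..}|lborel. exp (- c * of_real t)) = 1 / c"
proof -
  have "((\<lambda>x. exp (- Re c * x)) has_integral exp (- Re c * 0) / Re c) {0..}"
    using has_integral_exp_minus_to_infinity[OF assms] .
  then have "(\<lambda>x. exp (- Re c * x)) absolutely_integrable_on {0..}"
    by (intro nonnegative_absolutely_integrable_1) (auto simp: integrable_on_def)
  then have *: "set_integrable lborel {0..} (\<lambda>x. exp (- Re c * x))"
    unfolding set_integrable_def by (subst (asm) integrable_completion) auto
  have int: "set_integrable lborel S (\<lambda>t::real. exp (- c * of_real t))" if "S \<subseteq> {0..}" "S \<in> sets borel" for S
    by (rule set_integrable_bound[OF set_integrable_subset[OF *]]) (use that in \<open>auto simp: set_borel_measurable_def\<close>)
  from int show "set_integrable lborel {0..} (\<lambda>t::real. exp (- c * of_real t))" by auto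
  have "c \<noteq> 0" using assms by auto
  have "(LBINT t=0..\<infinity>. exp (- c * of_real t)) = 0 - (- 1 / c)"
  proof (rule interval_integral_FTC_integrable)
    show "((\<lambda>t. - exp (- c * of_real t) / c) has_vector_derivative exp (- c * of_real t)) (at t)" for t :: real
      using \<open>c \<noteq> 0\<close> by (auto intro!: derivative_eq_intros has_vector_derivative_real_field simp: field_simps)
    show "set_integrable lborel (einterval 0 \<infinity>) (\<lambda>t. exp (- c * of_real t))"
      by (intro int) (auto simp: einterval_def)
    have "((\<lambda>t. - exp (- c * of_real t) / c) \<longlongrightarrow> - exp (- c * of_real 0) / c) (at_right 0)"
      using \<open>c \<noteq> 0\<close> by (intro tendsto_intros)
    then show "(((\<lambda>t. - exp (- c * of_real t) / c) \<circ> real_of_ereal) \<longlongrightarrow> - 1 / c) (at_right 0)"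
      by (simp add: zero_ereal_def ereal_tendsto_simps)
    have "((\<lambda>t. cmod (- exp (- c * of_real t) / c)) \<longlongrightarrow> 0) at_top"
    proof -
      have "((\<lambda>t. exp (- (Re c * t)) / cmod c) \<longlongrightarrow> 0 / cmod c) at_top"
        using assms \<open>c \<noteq> 0\<close>
        by (intro tendsto_intros filterlim_compose[OF exp_at_bot])
           (auto intro!: filterlim_tendsto_pos_mult_at_top[OF tendsto_const] filterlim_ident simp: filterlim_uminus_at_bot)
      then show ?thesis by (simp add: norm_divide)
    qed
    then have "((\<lambda>t. - exp (- c * of_real t) / c) \<longlongrightarrow> 0) at_top"
      by (rule tendsto_norm_zero_cancel)
    then show "(((\<lambda>t. - exp (- c * of_real t) / c) \<circ> real_of_ereal) \<longlongrightarrow> 0) (at_left \<infinity>)"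
      by (simp add: ereal_tendsto_simps)
  qed (auto intro!: continuous_intros)
  also have "(LBINT t=0..\<infinity>. exp (- c * of_real t)) = (LINT t:{0..}|lborel. exp (- c * of_real t))"
    unfolding interval_lebesgue_integral_0_infty set_lebesgue_integral_def
    by (rule integral_cong_AE) (use AE_lborel_singleton[of 0] in \<open>auto simp: indicator_def elim!: eventually_mono\<close>)
  finally show "(LINT t:{0..}|lborel. exp (- c * of_real t)) = 1 / c" by simp
qed

text \<open>The constant \<open>c\<close> must be allowed to be complex, since it becomes \<open>\<alpha> cnj \<mu>\<close> in the computation of
  the Toeplitz operator.\<close>
lemma complex_gaussian_integral:
  fixes c :: complex
  assumes "Re c > 0"
  shows "integrable lborel (\<lambda>z. exp (- c * of_real ((cmod z)\<^sup>2)))"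
    and "(LINT z|lborel. exp (- c * of_real ((cmod z)\<^sup>2))) = of_real pi / c"
proof -
  let ?D = "density lborel (\<lambda>t::real. ennreal (pi * indicator {0..} t))"
  let ?f = "\<lambda>t::real. exp (- c * of_real t)"
  have eq: "(pi * indicator {0..} t) *\<^sub>R ?f t = of_real pi * (indicator {0..} t *\<^sub>R ?f t)" for t
    by (simp add: scaleR_conv_of_real)
  have "integrable lborel (\<lambda>t. (pi * indicator {0..} t) *\<^sub>R ?f t)"
    unfolding eq using exp_minus_mult_integral(1)[OF assms] unfolding set_integrable_def
    by (rule integrable_mult_right)
  then have "integrable ?D ?f"
    by (subst integrable_density) auto
  then show "integrable lborel (\<lambda>z. exp (- c * of_real ((cmod z)\<^sup>2)))"
    unfolding distr_lborel_cmod_power2[symmetric] by (subst (asm) integrable_distr_eq) auto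
  have "(LINT z|lborel. exp (- c * of_real ((cmod z)\<^sup>2))) = (LINT t|distr lborel borel (\<lambda>z. (cmod z)\<^sup>2). ?f t)"
    by (subst integral_distr) auto
  also have "\<dots> = (LINT t|lborel. (pi * indicator {0..} t) *\<^sub>R ?f t)"
    unfolding distr_lborel_cmod_power2 by (subst integral_density) auto
  also have "\<dots> = of_real pi * (LINT t:{0..}|lborel. ?f t)"
    unfolding eq set_lebesgue_integral_def by (rule integral_mult_right_zero)
  also have "\<dots> = of_real pi / c" unfolding exp_minus_mult_integral(2)[OF assms] by simp
  finally show "(LINT z|lborel. exp (- c * of_real ((cmod z)\<^sup>2))) = of_real pi / c" .
qed

lemma entire_circle_mean:
  assumes "G holomorphic_on UNIV"
  shows "(LINT t:{0..1}|lborel. G (exp (2 * of_real pi * \<i> * of_real t) * \<zeta>)) = G 0"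
proof -
  let ?E = "\<lambda>t::real. exp (2 * of_real pi * \<i> * of_real t)"
  have hol: "(\<lambda>w. G (w * \<zeta>)) holomorphic_on UNIV"
    by (rule holomorphic_on_compose_gen[OF _ assms, of "\<lambda>w. w * \<zeta>", unfolded o_def])
       (auto intro!: holomorphic_intros)
  have "((\<lambda>u. G (u * \<zeta>) / (u - 0)) has_contour_integral (2 * of_real pi * \<i> * G (0 * \<zeta>))) (circlepath 0 1)"
    by (rule Cauchy_integral_circlepath_simple) (auto intro: holomorphic_on_subset[OF hol])
  then have "((\<lambda>t. G (?E t * \<zeta>) / ?E t * (2 * of_real pi * \<i> * ?E t)) has_integral 2 * of_real pi * \<i> * G (0 * \<zeta>)) {0..1}"
    unfolding has_contour_integral_def
    by (rule has_integral_eq[rotated]) (auto simp: vector_derivative_circlepath01, simp add: circlepath)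
  then have "((\<lambda>t. (2 * of_real pi * \<i>) * G (?E t * \<zeta>)) has_integral 2 * of_real pi * \<i> * G 0) {0..1}"
    by (simp add: mult.commute)
  from has_integral_mult_right[OF this, of "1 / (2 * of_real pi * \<i>)"]
  have HK: "((\<lambda>t. G (?E t * \<zeta>)) has_integral G 0) {0..1}" by simp
  have "continuous_on {0..1::real} (\<lambda>t. G (?E t * \<zeta>))"
    by (rule continuous_on_compose2[OF holomorphic_on_imp_continuous_on[OF assms]])
       (auto intro!: continuous_intros)
  then have "set_integrable lborel {0..1::real} (\<lambda>t. G (?E t * \<zeta>))"
    by (rule borel_integrable_atLeastAtMost')
  from set_borel_integral_eq_integral(2)[OF this] HK show ?thesis
    by (simp add: integral_unique)
qed

text \<open>The integral does not change when \<open>G\<close> is composed with a rotation about the origin.  Averaging over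
  all rotations and exchanging the integrals replaces \<open>G\<close> by its mean over circles, which is \<open>G 0\<close>.\<close>
lemma integral_entire_mult_radial:
  fixes G k :: "complex \<Rightarrow> complex"
  assumes G: "G holomorphic_on UNIV" and [measurable]: "k \<in> borel_measurable borel"
    and radial: "\<And>\<omega> \<zeta>. cmod \<omega> = 1 \<Longrightarrow> k (\<omega> * \<zeta>) = k \<zeta>"
    and int: "integrable lborel (\<lambda>\<zeta>. G \<zeta> * k \<zeta>)"
  shows "(LINT \<zeta>|lborel. G \<zeta> * k \<zeta>) = G 0 * (LINT \<zeta>|lborel. k \<zeta>)"
proof -
  let ?E = "\<lambda>t::real. exp (2 * of_real pi * \<i> * of_real t) :: complex"
  have E: "cmod (?E t) = 1" "?E t \<noteq> 0" for t
    by simp_all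
  have [measurable]: "G \<in> borel_measurable borel"
    using G by (intro borel_measurable_continuous_onI holomorphic_on_imp_continuous_on)
  let ?g = "\<lambda>t \<zeta>. indicator {0..1::real} t *\<^sub>R (G (?E t * \<zeta>) * k \<zeta>)"
  have rot: "integrable lborel (\<lambda>\<zeta>. G (?E t * \<zeta>) * k \<zeta>)"
    "(LINT \<zeta>|lborel. G (?E t * \<zeta>) * k \<zeta>) = (LINT \<zeta>|lborel. G \<zeta> * k \<zeta>)"
    "(LINT \<zeta>|lborel. cmod (G (?E t * \<zeta>) * k \<zeta>)) = (LINT \<zeta>|lborel. cmod (G \<zeta> * k \<zeta>))" for t
    using lborel_complex_integrable_affine_iff[OF E(2)[of t], of "\<lambda>\<zeta>. G \<zeta> * k \<zeta>" 0]
      lborel_complex_integral_affine[OF E(2)[of t], of "\<lambda>\<zeta>. G \<zeta> * k \<zeta>" 0]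
      lborel_complex_integral_affine[OF E(2)[of t], of "\<lambda>\<zeta>. cmod (G \<zeta> * k \<zeta>)" 0] int
    by (simp_all add: radial)
  have prod: "integrable (lborel \<Otimes>\<^sub>M lborel) (\<lambda>(t, \<zeta>). ?g t \<zeta>)"
  proof (rule lborel_pair.Fubini_integrable)
    have "(\<lambda>t. LINT \<zeta>|lborel. norm (?g t \<zeta>)) = (\<lambda>t. (LINT \<zeta>|lborel. cmod (G \<zeta> * k \<zeta>)) * indicator {0..1} t)"
      by (rule ext) (use rot(3) in \<open>simp add: indicator_def norm_mult\<close>)
    then show "integrable lborel (\<lambda>t. LINT \<zeta>|lborel. norm (case (t, \<zeta>) of (t, \<zeta>) \<Rightarrow> ?g t \<zeta>))"
      by simp
  qed (use rot(1) in auto)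
  have "(LINT \<zeta>|lborel. LINT t|lborel. ?g t \<zeta>) = (LINT t|lborel. LINT \<zeta>|lborel. ?g t \<zeta>)"
    by (rule lborel_pair.Fubini_integral[OF prod])
  also have "\<dots> = (LINT t|lborel. indicator {0..1::real} t *\<^sub>R (LINT \<zeta>|lborel. G \<zeta> * k \<zeta>))"
    by (simp only: integral_scaleR_right rot(2))
  also have "\<dots> = (LINT \<zeta>|lborel. G \<zeta> * k \<zeta>)"
  proof -
    have "(LINT t|lborel. indicator {0..1::real} t *\<^sub>R c) = c" for c :: complex
      by (subst integral_scaleR_left) auto
    then show ?thesis .
  qed
  also have "(LINT \<zeta>|lborel. LINT t|lborel. ?g t \<zeta>) = (LINT \<zeta>|lborel. G 0 * k \<zeta>)"
  proof (rule Bochner_Integration.integral_cong[OF refl])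
    fix \<zeta>
    have "(LINT t|lborel. ?g t \<zeta>) = (LINT t|lborel. (indicator {0..1::real} t *\<^sub>R G (?E t * \<zeta>)) * k \<zeta>)"
      by simp
    also have "\<dots> = (LINT t:{0..1}|lborel. G (?E t * \<zeta>)) * k \<zeta>"
      unfolding set_lebesgue_integral_def by (rule integral_mult_left_zero)
    finally show "(LINT t|lborel. ?g t \<zeta>) = G 0 * k \<zeta>"
      using entire_circle_mean[OF G, of \<zeta>] by simp
  qed
  finally show ?thesis by simp
qed

section \<open>Gaussians and injectivity of the Fourier transform\<close>

text \<open>Moving the origin to \<open>q / t\<close> removes the term in \<open>cnj \<xi>\<close>.  What remains is an entire factor times
  a radial Gaussian, so the mean value property applies.\<close>
lemma complex_gaussian_exp_integral:
  fixes p q :: complex and t :: real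
  assumes "t > 0"
  shows "integrable lborel (\<lambda>\<xi>. exp (p * \<xi> + q * cnj \<xi> - of_real t * of_real ((cmod \<xi>)\<^sup>2)))"
    and "(LINT \<xi>|lborel. exp (p * \<xi> + q * cnj \<xi> - of_real t * of_real ((cmod \<xi>)\<^sup>2))) =
           of_real (pi / t) * exp (p * q / of_real t)"
proof -
  have int: "integrable lborel (\<lambda>\<xi>. exp (p * \<xi> + q * cnj \<xi> - of_real t * of_real ((cmod \<xi>)\<^sup>2)))" for p q
  proof -
    define K where "K = cmod p + cmod q"
    have bound: "cmod (exp (p * \<xi> + q * cnj \<xi> - of_real t * of_real ((cmod \<xi>)\<^sup>2)))
        \<le> cmod (of_real (exp (K\<^sup>2 / (2 * t))) * exp (- of_real (t / 2) * of_real ((cmod \<xi>)\<^sup>2)))" for \<xi>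
    proof -
      have "Re (p * \<xi> + q * cnj \<xi>) \<le> cmod (p * \<xi> + q * cnj \<xi>)" by (rule complex_Re_le_cmod)
      also have "\<dots> \<le> K * cmod \<xi>"
        using norm_triangle_ineq[of "p * \<xi>" "q * cnj \<xi>"] by (simp add: norm_mult K_def algebra_simps)
      also have "\<dots> \<le> K\<^sup>2 / (2 * t) + t / 2 * (cmod \<xi>)\<^sup>2"
      proof -
        \<comment> \<open>completing the square lets half of the Gaussian absorb the linear term\<close>
        have "0 \<le> (K - t * cmod \<xi>)\<^sup>2 / (2 * t)" using assms by simp
        also have "\<dots> = K\<^sup>2 / (2 * t) + t / 2 * (cmod \<xi>)\<^sup>2 - K * cmod \<xi>"
          using assms by (simp add: power2_eq_square field_simps)
        finally show ?thesis by simp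
      qed
      finally have "Re (p * \<xi> + q * cnj \<xi>) - t * (cmod \<xi>)\<^sup>2 \<le> K\<^sup>2 / (2 * t) - t / 2 * (cmod \<xi>)\<^sup>2"
        by simp
      then show ?thesis
        by (simp add: norm_mult exp_add[symmetric] flip: of_real_power of_real_mult exp_of_real)
    qed
    have "integrable lborel (\<lambda>\<xi>::complex. of_real (exp (K\<^sup>2 / (2 * t))) * exp (- of_real (t / 2) * of_real ((cmod \<xi>)\<^sup>2)) :: complex)"
      using assms by (intro integrable_mult_right complex_gaussian_integral(1)) simp
    then show ?thesis
      by (rule Bochner_Integration.integrable_bound)
         (use bound in \<open>auto intro!: borel_measurable_continuous_onI continuous_intros\<close>)
  qed
  from int show "integrable lborel (\<lambda>\<xi>. exp (p * \<xi> + q * cnj \<xi> - of_real t * of_real ((cmod \<xi>)\<^sup>2)))" .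
  define \<eta> where "\<eta> = q / of_real t"
  have shift: "exp (p * (\<eta> + 1 * \<zeta>) + q * cnj (\<eta> + 1 * \<zeta>) - of_real t * of_real ((cmod (\<eta> + 1 * \<zeta>))\<^sup>2)) =
      exp (p * q / of_real t) * (exp ((p - cnj q) * \<zeta>) * exp (- of_real t * of_real ((cmod \<zeta>)\<^sup>2)))" for \<zeta>
  proof -
    have q: "q = of_real t * \<eta>" and t: "complex_of_real t \<noteq> 0" using assms by (auto simp: \<eta>_def)
    show ?thesis
      unfolding exp_add[symmetric] complex_norm_square unfolding q
      using t by (intro arg_cong[where f = exp]) (simp add: field_simps)
  qed
  have "(LINT \<xi>|lborel. exp (p * \<xi> + q * cnj \<xi> - of_real t * of_real ((cmod \<xi>)\<^sup>2))) =
      (LINT \<zeta>|lborel. exp (p * q / of_real t) * (exp ((p - cnj q) * \<zeta>) * exp (- of_real t * of_real ((cmod \<zeta>)\<^sup>2))))"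
    by (subst lborel_complex_integral_affine[of 1 _ \<eta>]) (simp_all only: shift, simp_all)
  also have "\<dots> = exp (p * q / of_real t) *
      (LINT \<zeta>|lborel. exp ((p - cnj q) * \<zeta>) * exp (- of_real t * of_real ((cmod \<zeta>)\<^sup>2)))"
    by (rule integral_mult_right_zero)
  also have "(LINT \<zeta>|lborel. exp ((p - cnj q) * \<zeta>) * exp (- of_real t * of_real ((cmod \<zeta>)\<^sup>2))) =
      exp ((p - cnj q) * 0) * (LINT \<zeta>|lborel. exp (- of_real t * of_real ((cmod \<zeta>)\<^sup>2)))"
  proof (rule integral_entire_mult_radial)
    show "integrable lborel (\<lambda>\<zeta>. exp ((p - cnj q) * \<zeta>) * exp (- of_real t * of_real ((cmod \<zeta>)\<^sup>2)))"
      using int[of "p - cnj q" 0] by (simp add: exp_add[symmetric])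
  qed (auto simp: norm_mult intro!: holomorphic_intros)
  also have "(LINT \<zeta>|lborel. exp (- of_real t * of_real ((cmod \<zeta>)\<^sup>2))) = of_real pi / complex_of_real t"
    using assms by (intro complex_gaussian_integral(2)) simp
  finally show "(LINT \<xi>|lborel. exp (p * \<xi> + q * cnj \<xi> - of_real t * of_real ((cmod \<xi>)\<^sup>2))) =
           of_real (pi / t) * exp (p * q / of_real t)"
    by simp
qed

lemma integrable_lborel_mult_prod:
  fixes f :: "'a::euclidean_space \<Rightarrow> complex" and g :: "'b::euclidean_space \<Rightarrow> complex"
  assumes "integrable lborel f" "integrable lborel g"
  shows "integrable (lborel \<Otimes>\<^sub>M lborel) (\<lambda>(x, y). f x * g y)"
proof (rule lborel_pair.Fubini_integrable)
  have [measurable]: "f \<in> borel_measurable borel" "g \<in> borel_measurable borel"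
    using assms by auto
  show "(\<lambda>(x, y). f x * g y) \<in> borel_measurable (lborel \<Otimes>\<^sub>M lborel)"
    by measurable
  show "integrable lborel (\<lambda>x. LINT y|lborel. norm (case (x, y) of (x, y) \<Rightarrow> f x * g y))"
    using assms by (simp add: norm_mult)
qed (use assms in simp)

lemma borel_measurable_cnj [measurable]: "cnj \<in> borel_measurable borel"
  by (intro borel_measurable_continuous_onI continuous_intros)

text \<open>Writing points of the plane as complex numbers, \<open>exp (\<xi> cnj u - cnj \<xi> u)\<close> is unimodular and the
  inner integral is the Fourier transform of \<open>g\<close>.  Since the transform of a Gaussian is a Gaussian,
  pairing with a modulated Gaussian of width controlled by \<open>t\<close> gives, up to a constant, a Gaussian
  average of \<open>g\<close> around \<open>x\<close>.\<close>
lemma fourier_gaussian_pairing: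
  fixes g :: "complex \<Rightarrow> complex" and x :: complex
  assumes g: "integrable lborel g" and t: "t > 0"
  shows "(LINT \<xi>|lborel. (LINT u|lborel. g u * exp (\<xi> * cnj u - cnj \<xi> * u)) *
             exp (cnj \<xi> * x - \<xi> * cnj x - of_real t * of_real ((cmod \<xi>)\<^sup>2))) =
         of_real (pi / t) * (LINT u|lborel. g u * of_real (exp (- (cmod (u - x))\<^sup>2 / t)))"
proof -
  have [measurable]: "g \<in> borel_measurable borel" using g by auto
  let ?h = "\<lambda>\<xi> u. g u * exp (cnj (u - x) * \<xi> + (x - u) * cnj \<xi> - of_real t * of_real ((cmod \<xi>)\<^sup>2))"
  have "integrable (lborel \<Otimes>\<^sub>M lborel) (\<lambda>(\<xi>, u). exp (- of_real t * of_real ((cmod \<xi>)\<^sup>2)) * g u)"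
    using t by (intro integrable_lborel_mult_prod complex_gaussian_integral(1) g) simp
  then have prod: "integrable (lborel \<Otimes>\<^sub>M lborel) (\<lambda>(\<xi>, u). ?h \<xi> u)"
  proof (rule Bochner_Integration.integrable_bound)
    have "Re (cnj (u - x) * \<xi> + (x - u) * cnj \<xi>) = 0" for u \<xi>
      by (simp add: algebra_simps)
    then show "AE z in lborel \<Otimes>\<^sub>M lborel. norm (case z of (\<xi>, u) \<Rightarrow> ?h \<xi> u)
        \<le> norm (case z of (\<xi>, u) \<Rightarrow> exp (- of_real t * of_real ((cmod \<xi>)\<^sup>2)) * g u)"
      by (auto simp: norm_mult simp flip: of_real_power of_real_mult)
  qed measurable
  have "(LINT \<xi>|lborel. (LINT u|lborel. g u * exp (\<xi> * cnj u - cnj \<xi> * u)) *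
             exp (cnj \<xi> * x - \<xi> * cnj x - of_real t * of_real ((cmod \<xi>)\<^sup>2))) =
        (LINT \<xi>|lborel. LINT u|lborel. ?h \<xi> u)"
    unfolding integral_mult_left_zero[symmetric] mult.assoc exp_add[symmetric]
    by (simp add: algebra_simps)
  also have "\<dots> = (LINT u|lborel. LINT \<xi>|lborel. ?h \<xi> u)"
    by (rule lborel_pair.Fubini_integral[OF prod, symmetric])
  also have "\<dots> = (LINT u|lborel. of_real (pi / t) * (g u * of_real (exp (- (cmod (u - x))\<^sup>2 / t))))"
  proof (rule Bochner_Integration.integral_cong[OF refl])
    fix u
    have "(LINT \<xi>|lborel. ?h \<xi> u) = g u * (of_real (pi / t) * exp (cnj (u - x) * (x - u) / of_real t))"
      by (subst integral_mult_right_zero, subst complex_gaussian_exp_integral(2)[OF t]) (rule refl)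
    also have "cnj (u - x) * (x - u) / of_real t = of_real (- (cmod (u - x))\<^sup>2 / t)"
      unfolding of_real_divide of_real_minus complex_norm_square by (simp add: algebra_simps)
    finally show "(LINT \<xi>|lborel. ?h \<xi> u) = of_real (pi / t) * (g u * of_real (exp (- (cmod (u - x))\<^sup>2 / t)))"
      by (simp only: exp_of_real ac_simps)
  qed
  also have "\<dots> = of_real (pi / t) * (LINT u|lborel. g u * of_real (exp (- (cmod (u - x))\<^sup>2 / t)))"
    by (rule integral_mult_right_zero)
  finally show ?thesis .
qed

text \<open>Integrating the Gaussian averages over centres \<open>x\<close> in the box pairs \<open>g\<close> with a smoothed indicator
  function of the box.  As the Gaussians concentrate, these converge to the indicator function away
  from the frontier, which has measure zero.\<close>
lemma gaussian_averages_zero_imp_box_integral_zero: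
  fixes g :: "complex \<Rightarrow> complex"
  assumes g: "integrable lborel g"
    and zero: "\<And>x t. t > 0 \<Longrightarrow> (LINT u|lborel. g u * of_real (exp (- (cmod (u - x))\<^sup>2 / t))) = 0"
  shows "(LINT u:cbox a b|lborel. g u) = 0"
proof -
  have [measurable]: "g \<in> borel_measurable borel" using g by auto
  let ?B = "\<lambda>x. indicator (cbox a b) x :: complex"
  \<comment> \<open>the width of the \<open>n\<close>-th Gaussian; \<open>k n\<close> is the correspondingly smoothed box, scaled by \<open>pi\<close>\<close>
  define s where "s n = (1 / real (Suc n))" for n
  have s: "s n > 0" for n by (simp add: s_def)
  define k where "k n u = (LINT y|lborel. ?B (u + of_real (s n) * y) * of_real (exp (- (cmod y)\<^sup>2)))" for n u
  have gauss: "integrable lborel (\<lambda>y::complex. exp (- (cmod y)\<^sup>2))"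
      "(LINT y|lborel. of_real (exp (- (cmod (y::complex))\<^sup>2))) = complex_of_real pi"
    using complex_gaussian_integral[of 1] integrable_norm[OF complex_gaussian_integral(1)[of 1]]
    by (simp_all add: exp_of_real[symmetric])
  have gauss_le: "cmod (?B (u + of_real (s n) * y) * of_real (exp (- (cmod y)\<^sup>2))) \<le> exp (- (cmod y)\<^sup>2)" for u n y
    by (simp add: norm_mult indicator_def)
  have kzero: "(LINT u|lborel. g u * k n u) = 0" for n
  proof -
    let ?e = "\<lambda>x u::complex. of_real (exp (- (cmod (u - x))\<^sup>2 / (s n)\<^sup>2)) :: complex"
    have prod: "integrable (lborel \<Otimes>\<^sub>M lborel) (\<lambda>(x, u). ?B x * g u)"
    proof (intro integrable_lborel_mult_prod g)
      have "integrable lborel (\<lambda>x. complex_of_real (indicator (cbox a b) x))"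
        by (intro integrable_of_real integrable_real_indicator) (auto simp: emeasure_lborel_cbox_eq less_top[symmetric])
      then show "integrable lborel ?B" by (simp add: indicator_def of_bool_def if_distrib cong: if_cong)
    qed
    then have prod': "integrable (lborel \<Otimes>\<^sub>M lborel) (\<lambda>(x, u). ?B x * (g u * ?e x u))"
      by (rule Bochner_Integration.integrable_bound)
         (auto simp: norm_mult intro!: AE_I2 mult_left_mono mult_left_le)
    have k: "k n u = of_real (1 / (s n)\<^sup>2) * (LINT x|lborel. ?B x * ?e x u)" for u
    proof -
      have "cmod (u - (u + of_real (s n) * y)) = s n * cmod y" for y
        using s[of n] by (simp add: norm_mult)
      then have "?e (u + of_real (s n) * y) u = of_real (exp (- (cmod y)\<^sup>2))" for y
        using s[of n] by (simp add: power_mult_distrib)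
      then show ?thesis
        using s[of n] lborel_complex_integral_affine[of "of_real (s n)" "\<lambda>x. ?B x * ?e x u" u]
        by (simp add: k_def scaleR_conv_of_real)
    qed
    have "(LINT u|lborel. g u * k n u) = (LINT u|lborel. of_real (1 / (s n)\<^sup>2) * (LINT x|lborel. ?B x * (g u * ?e x u)))"
    proof (rule Bochner_Integration.integral_cong[OF refl])
      fix u
      have "g u * (LINT x|lborel. ?B x * ?e x u) = (LINT x|lborel. ?B x * (g u * ?e x u))"
        unfolding integral_mult_right_zero[symmetric] by (simp add: ac_simps)
      then show "g u * k n u = of_real (1 / (s n)\<^sup>2) * (LINT x|lborel. ?B x * (g u * ?e x u))"
        unfolding k by (simp add: ac_simps)
    qed
    also have "\<dots> = of_real (1 / (s n)\<^sup>2) * (LINT u|lborel. LINT x|lborel. ?B x * (g u * ?e x u))"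
      by (rule integral_mult_right_zero)
    also have "(LINT u|lborel. LINT x|lborel. ?B x * (g u * ?e x u)) = (LINT x|lborel. LINT u|lborel. ?B x * (g u * ?e x u))"
      by (rule lborel_pair.Fubini_integral[OF prod'])
    also have "\<dots> = (LINT x|lborel. ?B x * (LINT u|lborel. g u * ?e x u))"
      by (simp only: integral_mult_right_zero)
    also have "\<dots> = 0"
    proof -
      have "(LINT u|lborel. g u * ?e x u) = 0" for x
        by (rule zero) (use s[of n] in simp)
      then show ?thesis by simp
    qed
    finally show ?thesis by simp
  qed
  have klim: "(\<lambda>n. k n u) \<longlonglongrightarrow> ?B u * of_real pi" if u: "u \<notin> frontier (cbox a b)" for u
  proof -
    have "(\<lambda>n. k n u) \<longlonglongrightarrow> (LINT y|lborel. ?B u * of_real (exp (- (cmod y)\<^sup>2)))"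
      unfolding k_def
    proof (rule integral_dominated_convergence[where w = "\<lambda>y. exp (- (cmod y)\<^sup>2)"])
      show "AE y in lborel. (\<lambda>n. ?B (u + of_real (s n) * y) * of_real (exp (- (cmod y)\<^sup>2)))
          \<longlonglongrightarrow> ?B u * of_real (exp (- (cmod y)\<^sup>2))"
      proof (intro AE_I2 tendsto_intros)
        fix y
        have "(\<lambda>n. u + of_real (s n) * y) \<longlonglongrightarrow> u + of_real 0 * y"
          unfolding s_def by (intro tendsto_intros LIMSEQ_Suc lim_1_over_n)
        then have lim: "(\<lambda>n. u + of_real (s n) * y) \<longlonglongrightarrow> u" by simp
        have "u \<in> box a b \<or> u \<in> - cbox a b"
          using u by (auto simp: frontier_def interior_cbox)
        then have "\<forall>\<^sub>F n in sequentially. ?B (u + of_real (s n) * y) = ?B u"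
        proof
          assume "u \<in> box a b"
          from topological_tendstoD[OF lim open_box this] show ?thesis
            by eventually_elim (use \<open>u \<in> box a b\<close> box_subset_cbox[of a b] in \<open>auto simp: indicator_def\<close>)
        next
          assume "u \<in> - cbox a b"
          from topological_tendstoD[OF lim open_Compl[OF closed_cbox] this] show ?thesis
            by eventually_elim (use \<open>u \<in> - cbox a b\<close> in \<open>auto simp: indicator_def\<close>)
        qed
        then show "(\<lambda>n. ?B (u + of_real (s n) * y)) \<longlonglongrightarrow> ?B u"
          by (rule tendsto_eventually)
      qed
    qed (use gauss gauss_le in auto)
    also have "(LINT y|lborel. ?B u * of_real (exp (- (cmod y)\<^sup>2))) = ?B u * of_real pi"
      unfolding gauss(2)[symmetric] by (rule integral_mult_right_zero)
    finally show ?thesis .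
  qed
  have kle: "cmod (k n u) \<le> pi" for n u
  proof -
    have "cmod (k n u) \<le> (LINT y|lborel. exp (- (cmod (y::complex))\<^sup>2))"
      unfolding k_def using gauss(1) gauss_le
      by (intro Bochner_Integration.integral_norm_bound_integral[OF Bochner_Integration.integrable_bound[OF gauss(1)]]) auto
    also have "\<dots> = pi"
      using gauss(2) by (simp only: integral_complex_of_real of_real_eq_iff)
    finally show ?thesis .
  qed
  have [measurable]: "k n \<in> borel_measurable borel" for n
    unfolding k_def by measurable
  have "(\<lambda>n. LINT u|lborel. g u * k n u) \<longlonglongrightarrow> (LINT u|lborel. g u * (?B u * of_real pi))"
  proof (rule integral_dominated_convergence[where w = "\<lambda>u. cmod (g u) * pi"])
    have "AE u in lebesgue. u \<notin> frontier (cbox a b)"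
      using AE_not_in[of "frontier (cbox a b)" lebesgue] negligible_frontier_interval(1)[of a b]
      by (simp add: negligible_iff_null_sets frontier_cbox)
    then have "AE u in lborel. u \<notin> frontier (cbox a b)"
      by (subst (asm) AE_completion_iff) auto
    then show "AE u in lborel. (\<lambda>n. g u * k n u) \<longlonglongrightarrow> g u * (?B u * of_real pi)"
      by eventually_elim (intro tendsto_intros klim)
    show "AE u in lborel. cmod (g u * k n u) \<le> cmod (g u) * pi" for n
      using kle by (auto simp: norm_mult intro!: mult_left_mono)
  qed (use g in auto)
  then have "(LINT u|lborel. g u * (?B u * of_real pi)) = 0"
    unfolding kzero by (simp add: LIMSEQ_const_iff)
  moreover have "g u * (?B u * of_real pi) = (indicator (cbox a b) u *\<^sub>R g u) * of_real pi" for u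
    by (simp add: indicator_def)
  ultimately have "(LINT u|lborel. indicator (cbox a b) u *\<^sub>R g u) * of_real pi = 0"
    by (simp only: integral_mult_left_zero)
  then show ?thesis
    unfolding set_lebesgue_integral_def by simp
qed

text \<open>By Lebesgue's differentiation theorem \<open>g\<close> is almost everywhere the limit of its averages over small
  cubes, all of which vanish.\<close>
lemma AE_zero_if_box_integrals_zero:
  fixes g :: "'a::euclidean_space \<Rightarrow> complex"
  assumes g: "integrable lborel g" and zero: "\<And>a b. (LINT u:cbox a b|lborel. g u) = 0"
  shows "AE u in lborel. g u = 0"
proof -
  have set: "set_integrable lborel (cbox a b) g" for a b
    unfolding set_integrable_def by (rule integrable_mult_indicator[OF _ g]) simp
  have int: "g integrable_on cbox a b" "integral (cbox a b) g = 0" for a b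
    using set_borel_integral_eq_integral[OF set[of a b]] zero[of a b] by auto
  obtain N where N: "negligible N"
    and conv: "\<And>x e. \<lbrakk>x \<notin> N; 0 < e\<rbrakk> \<Longrightarrow> \<exists>d>0. \<forall>h. 0 < h \<and> h < d \<longrightarrow>
      norm (integral (cbox x (x + h *\<^sub>R One)) g /\<^sub>R h ^ DIM('a) - g x) < e"
    using integrable_ccontinuous_explicit[of g] int(1) by blast
  have gz: "g x = 0" if x: "x \<notin> N" for x
  proof (rule ccontr)
    assume "g x \<noteq> 0"
    then obtain d where "d > 0" "\<forall>h. 0 < h \<and> h < d \<longrightarrow>
      norm (integral (cbox x (x + h *\<^sub>R One)) g /\<^sub>R h ^ DIM('a) - g x) < norm (g x)"
      using conv[OF x, of "norm (g x)"] by auto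
    from this(2)[rule_format, of "d / 2"] this(1) show False by (simp add: int(2))
  qed
  have "AE x in lebesgue. x \<notin> N"
    using N by (auto simp: negligible_iff_null_sets intro: AE_not_in)
  then have "AE x in lebesgue. g x = 0" by eventually_elim (rule gz)
  then show ?thesis
    using g by (subst (asm) AE_completion_iff) auto
qed

lemma fourier_zero_imp_AE_zero:
  fixes g :: "complex \<Rightarrow> complex"
  assumes g: "integrable lborel g"
    and zero: "\<And>\<xi>. (LINT u|lborel. g u * exp (\<xi> * cnj u - cnj \<xi> * u)) = 0"
  shows "AE u in lborel. g u = 0"
proof (rule AE_zero_if_box_integrals_zero[OF g], rule gaussian_averages_zero_imp_box_integral_zero[OF g])
  show "(LINT u|lborel. g u * of_real (exp (- (cmod (u - x))\<^sup>2 / t))) = 0" if "t > 0" for x t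
    using fourier_gaussian_pairing[OF g that, of x] that by (simp add: zero)
qed

section \<open>The maximum principle forces an affine map\<close>

lemma maximum_modulus_circle:
  fixes H :: "complex \<Rightarrow> complex"
  assumes "H holomorphic_on UNIV" "r > 0" "\<And>z. cmod z = r \<Longrightarrow> cmod (H z) \<le> M"
  shows "cmod (H 0) \<le> M"
  by (rule maximum_modulus_frontier[of H "ball 0 r"])
     (use assms in \<open>auto intro: holomorphic_on_subset holomorphic_on_imp_continuous_on
        holomorphic_on_subset[THEN holomorphic_on_imp_continuous_on]\<close>)

text \<open>The remainder after division by \<open>z ^ n\<close> is again entire, being the shifted power series.\<close>
lemma entire_taylor_remainder:
  assumes "\<phi> holomorphic_on UNIV"
  obtains q where "q holomorphic_on UNIV" "q 0 = (deriv ^^ n) \<phi> 0 / fact n"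
    "\<And>z. \<phi> z = (\<Sum>k<n. (deriv ^^ k) \<phi> 0 / fact k * z ^ k) + z ^ n * q z"
proof -
  define c where "c k = (deriv ^^ k) \<phi> 0 / fact k" for k
  define q where "q z = (if z = 0 then c n else (\<phi> z - (\<Sum>k<n. c k * z ^ k)) / z ^ n)" for z
  have \<phi>: "(\<lambda>k. c k * z ^ k) sums \<phi> z" for z
    using holomorphic_power_series[of \<phi> 0 "cmod z + 1" z] assms
    by (auto simp: c_def intro: holomorphic_on_subset)
  have q: "(\<lambda>k. c (k + n) * z ^ k) sums q z" for z
  proof (cases "z = 0")
    case True
    then show ?thesis using powser_sums_zero[of "\<lambda>k. c (k + n)"] by (simp add: q_def)
  next
    case False
    have "(\<lambda>k. c (k + n) * z ^ (k + n) / z ^ n) sums ((\<phi> z - (\<Sum>k<n. c k * z ^ k)) / z ^ n)"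
      by (intro sums_divide sums_split_initial_segment \<phi>)
    then show ?thesis using False by (simp add: q_def power_add)
  qed
  have "q holomorphic_on UNIV"
    unfolding holomorphic_on_def
  proof
    fix w :: complex
    have "q holomorphic_on ball 0 (cmod w + 1)"
      by (rule power_series_holomorphic[of 0 _ "\<lambda>k. c (k + n)"]) (use q in simp)
    then show "q field_differentiable at w within UNIV"
      by (auto intro!: holomorphic_on_imp_differentiable_at)
  qed
  moreover have "\<phi> z = (\<Sum>k<n. c k * z ^ k) + z ^ n * q z" for z
  proof (cases "z = 0")
    case True
    then show ?thesis
      using \<phi>[of 0] powser_sums_zero[of c]
      by (cases n) (auto simp: q_def sum.lessThan_Suc_shift dest: sums_unique2)
  qed (simp add: q_def)
  ultimately show ?thesis using that by (auto simp: c_def q_def)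
qed

text \<open>On the circle \<open>\<bar>z\<bar> = r\<close>, choose \<open>w = 2 C z ^ n - z\<close> with \<open>C = c\<^sub>n\<close>.  There
  \<open>\<bar>z + w\<bar>\<^sup>2 / 4 = \<bar>C\<bar>\<^sup>2 r ^ (2 n)\<close>, and \<open>z cnj z = r\<^sup>2\<close> turns \<open>\<phi> z cnj w\<close> into a combination of powers of
  \<open>z\<close> and powers of \<open>cnj z\<close>.  Conjugating the latter does not affect real parts, so the exponent in the
  hypothesis is \<open>Re (P z)\<close> for an entire function \<open>P\<close>, and the maximum principle applies to
  \<open>\<psi> exp (- \<alpha> P)\<close>.  At the origin all the conjugated powers vanish, leaving the stated exponent.\<close>
lemma taylor_coeff_bound:
  fixes \<psi> \<phi> :: "complex \<Rightarrow> complex"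
  defines "c \<equiv> \<lambda>k. (deriv ^^ k) \<phi> 0 / fact k"
  assumes hol: "\<psi> holomorphic_on UNIV" "\<phi> holomorphic_on UNIV" and "\<alpha> > 0"
    and bound: "\<And>z w. cmod (\<psi> z) * exp (\<alpha> * Re (\<phi> z * cnj w)) \<le> M * exp (\<alpha> * (cmod (z + w))\<^sup>2 / 4)"
    and r: "r > 0"
  shows "cmod (\<psi> 0) * exp (\<alpha> * ((cmod (c n))\<^sup>2 * r ^ (2 * n) - r\<^sup>2 * Re (c 1))) \<le> M"
proof -
  obtain q where q: "q holomorphic_on UNIV" "q 0 = c n"
    and \<phi>q: "\<And>z. \<phi> z = (\<Sum>k<n. c k * z ^ k) + z ^ n * q z"
    using entire_taylor_remainder[OF hol(2), of n] unfolding c_def by blast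
  obtain p where p: "p holomorphic_on UNIV" "p 0 = c 1" and \<phi>p: "\<And>z. \<phi> z = c 0 + z * p z"
    using entire_taylor_remainder[OF hol(2), of 1] unfolding c_def by auto
  define C where "C = c n"
  \<comment> \<open>the terms of \<open>\<phi> z cnj (C z ^ n)\<close> of degree below \<open>n\<close>, conjugated so as to become holomorphic\<close>
  define S where "S z = (\<Sum>k<n. C * cnj (c k) * of_real (r ^ (2 * k)) * z ^ (n - k))" for z
  define P where "P z = of_real ((cmod C)\<^sup>2 * r ^ (2 * n)) - 2 * (S z + cnj C * of_real (r ^ (2 * n)) * q z)
      + (cnj (c 0) * z + of_real (r\<^sup>2) * p z)" for z
  define H where "H z = \<psi> z * exp (- of_real \<alpha> * P z)" for z
  have "H holomorphic_on UNIV"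
    unfolding H_def P_def S_def by (intro holomorphic_intros hol p q)
  then have H0: "cmod (H 0) \<le> M"
  proof (rule maximum_modulus_circle[OF _ r])
    fix z assume z: "cmod z = r"
    have zz: "z * cnj z = of_real (r\<^sup>2)" by (simp add: z flip: complex_norm_square)
    have zk: "z ^ k * cnj z ^ k = of_real (r ^ (2 * k))" for k
      unfolding power_mult_distrib[symmetric] zz by (simp add: power_mult)
    define w where "w = 2 * (C * z ^ n) - z"
    have "\<phi> z * cnj (C * z ^ n) = cnj (S z) + cnj C * of_real (r ^ (2 * n)) * q z"
    proof -
      have "c k * z ^ k * (cnj C * cnj z ^ n) = cnj C * c k * of_real (r ^ (2 * k)) * cnj z ^ (n - k)" if "k < n" for k
      proof -
        have "cnj z ^ n = cnj z ^ k * cnj z ^ (n - k)" using that by (simp flip: power_add)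
        then show ?thesis unfolding zk[of k, symmetric] by (simp add: mult_ac)
      qed
      then have "(\<Sum>k<n. c k * z ^ k) * (cnj C * cnj z ^ n) = cnj (S z)"
        unfolding S_def sum_distrib_right cnj_sum by (intro sum.cong) simp_all
      moreover have "z ^ n * q z * (cnj C * cnj z ^ n) = cnj C * of_real (r ^ (2 * n)) * q z"
        unfolding zk[of n, symmetric] by (simp add: mult_ac)
      ultimately show ?thesis unfolding \<phi>q by (simp add: distrib_right)
    qed
    then have "Re (\<phi> z * cnj (C * z ^ n)) = Re (S z + cnj C * of_real (r ^ (2 * n)) * q z)"
      by simp
    moreover have "\<phi> z * cnj z = cnj (cnj (c 0) * z) + of_real (r\<^sup>2) * p z"
      unfolding \<phi>p zz[symmetric] by (simp add: algebra_simps)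
    then have "Re (\<phi> z * cnj z) = Re (cnj (c 0) * z + of_real (r\<^sup>2) * p z)"
      by simp
    moreover have "(cmod (z + w))\<^sup>2 / 4 = (cmod C)\<^sup>2 * r ^ (2 * n)"
      by (simp add: w_def norm_mult norm_power z power_mult_distrib power_mult power2_eq_square)
    moreover have "Re (\<phi> z * cnj w) = 2 * Re (\<phi> z * cnj (C * z ^ n)) - Re (\<phi> z * cnj z)"
      by (simp add: w_def algebra_simps)
    ultimately have ReP: "Re (P z) = (cmod (z + w))\<^sup>2 / 4 - Re (\<phi> z * cnj w)"
      unfolding P_def plus_complex.simps minus_complex.simps by simp
    have "- (\<alpha> * p) = \<alpha> * y + - (\<alpha> * x / 4)" if "p = x / 4 - y" for p x y :: real
      unfolding that by (simp add: algebra_simps)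
    note this[OF ReP]
    moreover have "cmod (H z) = cmod (\<psi> z) * exp (- (\<alpha> * Re (P z)))"
      by (simp add: H_def norm_mult)
    ultimately have "cmod (H z) = cmod (\<psi> z) * exp (\<alpha> * Re (\<phi> z * cnj w)) * exp (- (\<alpha> * (cmod (z + w))\<^sup>2 / 4))"
      by (simp only: exp_add mult.assoc)
    also have "\<dots> \<le> M * exp (\<alpha> * (cmod (z + w))\<^sup>2 / 4) * exp (- (\<alpha> * (cmod (z + w))\<^sup>2 / 4))"
      by (intro mult_right_mono bound) simp
    also have "\<dots> = M" by (simp flip: exp_add)
    finally show "cmod (H z) \<le> M" .
  qed
  have "S 0 = 0" unfolding S_def by (intro sum.neutral) (auto simp: power_0_left)
  moreover have "cnj C * of_real (r ^ (2 * n)) * C = of_real ((cmod C)\<^sup>2 * r ^ (2 * n))"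
    unfolding of_real_mult complex_norm_square by simp
  ultimately have "P 0 = of_real (- ((cmod C)\<^sup>2 * r ^ (2 * n))) + of_real (r\<^sup>2) * c 1"
    by (simp only: P_def q(2) p(2) C_def[symmetric]) simp
  then have "Re (P 0) = - ((cmod C)\<^sup>2 * r ^ (2 * n) - r\<^sup>2 * Re (c 1))"
    by (simp flip: of_real_power of_real_mult)
  note P0 = this
  have "cmod (H 0) = cmod (\<psi> 0) * exp (- (\<alpha> * Re (P 0)))"
    by (simp add: H_def norm_mult)
  with H0 show ?thesis
    by (simp only: P0 C_def mult_minus_right minus_minus)
qed

lemma nonpos_if_scaled_squares_bounded:
  fixes d K :: real
  assumes "\<And>r. r \<ge> 1 \<Longrightarrow> d * r\<^sup>2 \<le> K"
  shows "d \<le> 0"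
proof (rule ccontr)
  assume "\<not> d \<le> 0"
  then have d: "d > 0" by simp
  define r where "r = 1 + \<bar>K\<bar> / d"
  have r: "r \<ge> 1" using d by (simp add: r_def)
  have "K \<le> \<bar>K\<bar>" by simp
  also have "\<bar>K\<bar> < d * r" using d by (simp add: r_def distrib_left)
  also have "d * r \<le> d * r\<^sup>2" using d r by (simp add: power2_eq_square)
  finally show False using assms[OF r] by simp
qed

text \<open>The hypothesis is invariant under translation: recentring \<open>\<psi>\<close> and \<open>\<phi>\<close> at \<open>z0\<close> and shifting \<open>w\<close> by
  \<open>z0\<close> only multiplies \<open>\<psi>\<close> by a factor without zeros.  The coefficient bounds for all radii then leave
  only the affine part, because \<open>r ^ (2 n)\<close> with \<open>n \<ge> 2\<close> outgrows \<open>r\<^sup>2\<close>, and the bound for \<open>n = 1\<close>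
  compares the coefficients of \<open>r\<^sup>2\<close>.\<close>
lemma exponent_bound_imp_affine:
  fixes \<psi> \<phi> :: "complex \<Rightarrow> complex"
  assumes hol: "\<psi> holomorphic_on UNIV" "\<phi> holomorphic_on UNIV" and \<alpha>: "\<alpha> > 0"
    and bound: "\<And>z w. cmod (\<psi> z) * exp (\<alpha> * Re (\<phi> z * cnj w)) \<le> M * exp (\<alpha> * (cmod (z + w))\<^sup>2 / 4)"
    and nz: "\<psi> z0 \<noteq> 0"
  shows "\<exists>a \<mu>. (\<forall>z. \<phi> z = a + \<mu> * z) \<and> (cmod \<mu>)\<^sup>2 \<le> Re \<mu>"
proof -
  define \<phi>' where "\<phi>' z = \<phi> (z + z0)" for z
  define \<psi>' where "\<psi>' z = \<psi> (z + z0) * exp (- of_real \<alpha> * \<phi>' z * cnj z0)" for z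
  define c where "c k = (deriv ^^ k) \<phi>' 0 / fact k" for k
  have shift: "(\<lambda>z. f (z + z0)) holomorphic_on UNIV" if "f holomorphic_on UNIV" for f :: "complex \<Rightarrow> complex"
    by (rule holomorphic_on_compose_gen[OF _ that, of "\<lambda>z. z + z0", unfolded o_def])
       (auto intro!: holomorphic_intros)
  have hol': "\<phi>' holomorphic_on UNIV" "\<psi>' holomorphic_on UNIV"
    unfolding \<phi>'_def \<psi>'_def by (intro holomorphic_intros shift hol)+
  have bound': "cmod (\<psi>' z) * exp (\<alpha> * Re (\<phi>' z * cnj w)) \<le> M * exp (\<alpha> * (cmod (z + w))\<^sup>2 / 4)" for z w
  proof -
    have "cmod (\<psi>' z) * exp (\<alpha> * Re (\<phi>' z * cnj w)) =
        cmod (\<psi> (z + z0)) * exp (\<alpha> * Re (\<phi> (z + z0) * cnj (w - z0)))"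
      by (simp add: \<psi>'_def \<phi>'_def norm_mult algebra_simps flip: exp_add)
    also have "\<dots> \<le> M * exp (\<alpha> * (cmod ((z + z0) + (w - z0)))\<^sup>2 / 4)" by (rule bound)
    finally show ?thesis by simp
  qed
  define A where "A = cmod (\<psi>' 0)"
  have A: "A > 0" using nz by (simp add: A_def \<psi>'_def)
  define K where "K = ln (M / A) / \<alpha>"
  have le: "(cmod (c n))\<^sup>2 * r ^ (2 * n) - r\<^sup>2 * Re (c 1) \<le> K" if "r \<ge> 1" for r n
  proof -
    have "A * exp (\<alpha> * ((cmod (c n))\<^sup>2 * r ^ (2 * n) - r\<^sup>2 * Re (c 1))) \<le> M"
      unfolding A_def c_def using that by (intro taylor_coeff_bound[OF hol'(2,1) \<alpha> bound']) auto
    then have *: "exp (\<alpha> * ((cmod (c n))\<^sup>2 * r ^ (2 * n) - r\<^sup>2 * Re (c 1))) \<le> M / A"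
      using A by (simp add: field_simps)
    moreover have "M / A > 0" by (rule less_le_trans[OF exp_gt_zero *])
    ultimately have "\<alpha> * ((cmod (c n))\<^sup>2 * r ^ (2 * n) - r\<^sup>2 * Re (c 1)) \<le> ln (M / A)"
      by (subst ln_ge_iff)
    then show ?thesis using \<alpha> by (simp add: K_def field_simps)
  qed
  have "((cmod (c 1))\<^sup>2 - Re (c 1)) * r\<^sup>2 \<le> K" if "r \<ge> 1" for r
    using le[OF that, of 1] by (simp add: algebra_simps power2_eq_square)
  then have c1: "(cmod (c 1))\<^sup>2 \<le> Re (c 1)"
    using nonpos_if_scaled_squares_bounded[of "(cmod (c 1))\<^sup>2 - Re (c 1)" K] by simp
  have c0: "c n = 0" if n: "n \<ge> 2" for n
  proof -
    have "(cmod (c n))\<^sup>2 * r\<^sup>2 \<le> \<bar>Re (c 1)\<bar> + \<bar>K\<bar>" if r: "r \<ge> 1" for r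
    proof -
      have r2: "1 \<le> r\<^sup>2" using r by simp
      have "r ^ 4 \<le> r ^ (2 * n)" using r n by (intro power_increasing) auto
      then have "(cmod (c n))\<^sup>2 * r ^ 4 \<le> (cmod (c n))\<^sup>2 * r ^ (2 * n)" by (intro mult_left_mono) auto
      also have "\<dots> \<le> r\<^sup>2 * Re (c 1) + K" using le[OF r, of n] by simp
      also have "\<dots> \<le> r\<^sup>2 * \<bar>Re (c 1)\<bar> + r\<^sup>2 * \<bar>K\<bar>"
        using r2 mult_right_mono[OF r2, of "\<bar>K\<bar>"] by (intro add_mono mult_left_mono) auto
      finally have "r\<^sup>2 * ((cmod (c n))\<^sup>2 * r\<^sup>2) \<le> r\<^sup>2 * (\<bar>Re (c 1)\<bar> + \<bar>K\<bar>)"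
        by (simp add: algebra_simps flip: power_add)
      then show ?thesis using r by simp
    qed
    from nonpos_if_scaled_squares_bounded[OF this] show ?thesis by simp
  qed
  have lin: "\<phi>' z = c 0 + c 1 * z" for z
  proof -
    have "(\<lambda>k. c k * z ^ k) sums \<phi>' z"
      using holomorphic_power_series[of \<phi>' 0 "cmod z + 1" z] hol'
      by (auto simp: c_def intro: holomorphic_on_subset)
    moreover have "(\<lambda>k. c k * z ^ k) sums (\<Sum>k\<in>{0, 1}. c k * z ^ k)"
      by (rule sums_finite) (use c0 in \<open>auto simp: numeral_2_eq_2 less_Suc_eq not_less_eq_eq\<close>)
    ultimately show ?thesis by (auto dest: sums_unique2)
  qed
  have "\<phi> z = (c 0 - c 1 * z0) + c 1 * z" for z
    using lin[of "z - z0"] by (simp add: \<phi>'_def algebra_simps)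
  with c1 show ?thesis by blast
qed

section \<open>Toeplitz operators on reproducing kernels\<close>

lemma borel_measurable_entire:
  "h holomorphic_on UNIV \<Longrightarrow> h \<in> borel_measurable borel" for h :: "complex \<Rightarrow> complex"
  by (intro borel_measurable_continuous_onI holomorphic_on_imp_continuous_on)

lemma fock_space_iff:
  assumes "\<alpha> > 0"
  shows "h \<in> fock_space \<alpha> \<longleftrightarrow> h holomorphic_on UNIV \<and>
    integrable lborel (\<lambda>z. (cmod (h z))\<^sup>2 * exp (- \<alpha> * (cmod z)\<^sup>2))"
proof -
  have "integrable (fock_measure \<alpha>) (\<lambda>z. (cmod (h z))\<^sup>2) \<longleftrightarrow>
      integrable lborel (\<lambda>z. (cmod (h z))\<^sup>2 * exp (- \<alpha> * (cmod z)\<^sup>2))" if "h holomorphic_on UNIV"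
  proof -
    have [measurable]: "h \<in> borel_measurable borel" using that by (rule borel_measurable_entire)
    have "integrable (fock_measure \<alpha>) (\<lambda>z. (cmod (h z))\<^sup>2) \<longleftrightarrow>
        integrable lebesgue (\<lambda>z. (\<alpha> / pi * exp (- \<alpha> * (cmod z)\<^sup>2)) *\<^sub>R (cmod (h z))\<^sup>2)"
      unfolding fock_measure_def using assms
      by (intro integrable_density measurable_completion) auto
    also have "\<dots> \<longleftrightarrow> integrable lborel (\<lambda>z. (\<alpha> / pi) * ((cmod (h z))\<^sup>2 * exp (- \<alpha> * (cmod z)\<^sup>2)))"
      by (subst integrable_completion) (auto simp: ac_simps)
    also have "\<dots> \<longleftrightarrow> integrable lborel (\<lambda>z. (cmod (h z))\<^sup>2 * exp (- \<alpha> * (cmod z)\<^sup>2))"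
    proof
      assume "integrable lborel (\<lambda>z. (\<alpha> / pi) * ((cmod (h z))\<^sup>2 * exp (- \<alpha> * (cmod z)\<^sup>2)))"
      from integrable_mult_right[OF this, of "pi / \<alpha>"]
      show "integrable lborel (\<lambda>z. (cmod (h z))\<^sup>2 * exp (- \<alpha> * (cmod z)\<^sup>2))"
        using assms by simp
    qed (rule integrable_mult_right)
    finally show ?thesis .
  qed
  then show ?thesis by (auto simp: fock_space_def)
qed

lemma toeplitz_lborel:
  assumes [measurable]: "f \<in> borel_measurable borel" and "h holomorphic_on UNIV"
  shows "toeplitz \<alpha> f h z = of_real (\<alpha> / pi) *
     (LINT u|lborel. f u * h u * exp (of_real \<alpha> * z * cnj u - of_real \<alpha> * of_real ((cmod u)\<^sup>2)))"
proof -
  have [measurable]: "h \<in> borel_measurable borel" using assms(2) by (rule borel_measurable_entire)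
  show ?thesis unfolding toeplitz_def by (subst integral_completion) auto
qed

text \<open>Fubini's theorem will be applied on products of Borel measures, which requires a Borel function with
  a bound at every point in place of a Lebesgue measurable one bounded almost everywhere.\<close>
lemma Linfty_borel_representative:
  assumes "f \<in> Linfty"
  obtains g C where "g \<in> borel_measurable borel" "C \<ge> 0" "\<And>u. cmod (g u) \<le> C"
    "AE u in lebesgue. f u = g u"
    "\<And>\<alpha> h. h holomorphic_on UNIV \<Longrightarrow> toeplitz \<alpha> f h = toeplitz \<alpha> g h"
proof -
  from assms obtain C where f[measurable]: "f \<in> borel_measurable lebesgue"
    and C: "AE u in lebesgue. cmod (f u) \<le> C"
    by (auto simp: Linfty_def)
  obtain p where p[measurable]: "p \<in> borel_measurable lborel" and fp: "AE u in lborel. Re (f u) = p u"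
    using completion_ex_borel_measurable_real[of "\<lambda>u. Re (f u)" lborel] f by auto
  obtain q where q[measurable]: "q \<in> borel_measurable lborel" and fq: "AE u in lborel. Im (f u) = q u"
    using completion_ex_borel_measurable_real[of "\<lambda>u. Im (f u)" lborel] f by auto
  define D where "D = max C 0"
  define g0 where "g0 u = complex_of_real (p u) + \<i> * complex_of_real (q u)" for u
  define g where "g u = (if cmod (g0 u) \<le> D then g0 u else 0)" for u
  have [measurable]: "g0 \<in> borel_measurable borel" using p q unfolding g0_def by simp
  have g[measurable]: "g \<in> borel_measurable borel" unfolding g_def by measurable
  have fg: "AE u in lebesgue. f u = g u"
    using C fp[THEN AE_completion] fq[THEN AE_completion]
  proof eventually_elim
    case (elim u)
    then have "f u = g0 u" by (simp add: g0_def complex_eq_iff)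
    with elim show ?case by (auto simp: g_def D_def)
  qed
  have "toeplitz \<alpha> f h = toeplitz \<alpha> g h" if "h holomorphic_on UNIV" for \<alpha> h
  proof
    fix z
    have h[measurable]: "h \<in> borel_measurable borel" using that by (rule borel_measurable_entire)
    let ?e = "\<lambda>u. exp (of_real \<alpha> * z * cnj u - of_real \<alpha> * of_real ((cmod u)\<^sup>2))"
    have "?e \<in> borel_measurable lebesgue" "h \<in> borel_measurable lebesgue" and g': "g \<in> borel_measurable lebesgue"
      by (intro measurable_completion; simp)+
    then have m: "(\<lambda>u. k u * h u * ?e u) \<in> borel_measurable lebesgue" if "k \<in> borel_measurable lebesgue" for k
      using that by (intro borel_measurable_times)
    show "toeplitz \<alpha> f h z = toeplitz \<alpha> g h z"
      unfolding toeplitz_def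
      by (intro arg_cong2[where f = "(*)"] refl integral_cong_AE m f g') (use fg in \<open>auto elim!: eventually_mono\<close>)
  qed
  then show ?thesis
    using that[of g D] fg g by (auto simp: g_def D_def)
qed

lemma bounded_borel_in_Linfty:
  assumes "f \<in> borel_measurable borel" "\<And>u. cmod (f u) \<le> C"
  shows "f \<in> Linfty"
  using assms unfolding Linfty_def by (auto intro!: measurable_completion exI[of _ C])

lemma integrable_bounded_mult:
  fixes f k :: "complex \<Rightarrow> complex"
  assumes [measurable]: "f \<in> borel_measurable borel" and "\<And>u. cmod (f u) \<le> C" "integrable lborel k"
  shows "integrable lborel (\<lambda>u. f u * k u)"
proof (rule Bochner_Integration.integrable_bound)
  have [measurable]: "k \<in> borel_measurable borel" using assms(3) by auto
  show "integrable lborel (\<lambda>u. of_real C * k u)" using assms(3) by simp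
  have "0 \<le> C" using order.trans[OF norm_ge_zero assms(2)] .
  then show "AE u in lborel. cmod (f u * k u) \<le> cmod (of_real C * k u)"
    using assms(2) by (auto simp: norm_mult intro!: mult_right_mono)
  show "(\<lambda>u. f u * k u) \<in> borel_measurable lborel" by simp
qed

definition fock_kernel :: "real \<Rightarrow> complex \<Rightarrow> complex \<Rightarrow> complex" where
  "fock_kernel \<alpha> w u = exp (of_real \<alpha> * u * cnj w)"

lemma fock_kernel_holomorphic: "fock_kernel \<alpha> w holomorphic_on UNIV"
  unfolding fock_kernel_def by (intro holomorphic_intros)

lemma fock_kernel_in_fock_space:
  assumes "\<alpha> > 0"
  shows "fock_kernel \<alpha> w \<in> fock_space \<alpha>"
proof -
  have "(\<lambda>u. (cmod (fock_kernel \<alpha> w u))\<^sup>2 * exp (- \<alpha> * (cmod u)\<^sup>2)) =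
      (\<lambda>u. cmod (exp (2 * of_real \<alpha> * cnj w * u + 0 * cnj u - of_real \<alpha> * of_real ((cmod u)\<^sup>2))))"
    by (auto simp: fock_kernel_def power2_eq_square algebra_simps simp flip: exp_add)
  moreover have "integrable lborel \<dots>"
    by (rule integrable_norm[OF complex_gaussian_exp_integral(1)[OF assms]])
  ultimately show ?thesis
    using fock_kernel_holomorphic by (simp add: fock_space_iff[OF assms])
qed

lemma toeplitz_fock_kernel:
  assumes "f \<in> borel_measurable borel"
  shows "toeplitz \<alpha> f (fock_kernel \<alpha> w) z = of_real (\<alpha> / pi) *
     (LINT u|lborel. f u * exp (of_real \<alpha> * cnj w * u + of_real \<alpha> * z * cnj u - of_real \<alpha> * of_real ((cmod u)\<^sup>2)))"
proof -
  have "fock_kernel \<alpha> w u * exp (of_real \<alpha> * z * cnj u - of_real \<alpha> * of_real ((cmod u)\<^sup>2)) =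
      exp (of_real \<alpha> * cnj w * u + of_real \<alpha> * z * cnj u - of_real \<alpha> * of_real ((cmod u)\<^sup>2))" for u
    by (simp add: fock_kernel_def algebra_simps flip: exp_add)
  then show ?thesis
    by (simp add: toeplitz_lborel[OF assms fock_kernel_holomorphic] mult.assoc)
qed

text \<open>The modulus of the integrand depends on \<open>z\<close> and \<open>w\<close> only through \<open>z + w\<close>, and its integral is an
  explicit Gaussian.  This is sharper than the bound \<open>exp (\<alpha> (\<bar>z\<bar>\<^sup>2 + \<bar>w\<bar>\<^sup>2) / 2)\<close> that follows from
  boundedness of the operator, and the gain is what improves \<open>\<bar>\<mu>\<bar> \<le> 1\<close> to
  \<open>\<bar>\<mu>\<bar>\<^sup>2 \<le> Re \<mu>\<close> for the slope \<open>\<mu>\<close> of \<open>\<phi>\<close>.\<close>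
lemma toeplitz_fock_kernel_bound:
  assumes \<alpha>: "\<alpha> > 0" and f: "f \<in> borel_measurable borel" and C: "\<And>u. cmod (f u) \<le> C"
  shows "cmod (toeplitz \<alpha> f (fock_kernel \<alpha> w) z) \<le> C * exp (\<alpha> * (cmod (z + w))\<^sup>2 / 4)"
proof -
  \<comment> \<open>symmetrising the linear terms makes the exponent real without changing its real part\<close>
  define b where "b = of_real (\<alpha> / 2) * (z + w)"
  let ?e = "\<lambda>u. exp (of_real \<alpha> * cnj w * u + of_real \<alpha> * z * cnj u - of_real \<alpha> * of_real ((cmod u)\<^sup>2))"
  let ?r = "\<lambda>u. exp (cnj b * u + b * cnj u - of_real \<alpha> * of_real ((cmod u)\<^sup>2))"
  have r: "?r u = of_real (cmod (?e u))" for u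
  proof -
    have "cnj b * u + b * cnj u = of_real (Re (of_real \<alpha> * cnj w * u + of_real \<alpha> * z * cnj u))"
      by (simp add: b_def complex_eq_iff algebra_simps add_divide_distrib diff_divide_distrib)
    then show ?thesis by (simp flip: exp_of_real)
  qed
  have "complex_of_real (LINT u|lborel. cmod (?e u)) = (LINT u|lborel. ?r u)"
    unfolding r by (rule integral_complex_of_real[symmetric])
  also have "\<dots> = of_real (pi / \<alpha>) * exp (cnj b * b / of_real \<alpha>)"
    by (rule complex_gaussian_exp_integral(2)[OF \<alpha>])
  also have "cnj b * b / of_real \<alpha> = of_real (\<alpha> * (cmod (z + w))\<^sup>2 / 4)"
    unfolding of_real_mult of_real_divide complex_norm_square using \<alpha> by (simp add: b_def field_simps)
  also have "of_real (pi / \<alpha>) * exp \<dots> = complex_of_real (pi / \<alpha> * exp (\<alpha> * (cmod (z + w))\<^sup>2 / 4))"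
    by (simp only: exp_of_real of_real_mult)
  finally have e: "(LINT u|lborel. cmod (?e u)) = pi / \<alpha> * exp (\<alpha> * (cmod (z + w))\<^sup>2 / 4)"
    by (simp only: of_real_eq_iff)
  have "cmod (LINT u|lborel. f u * ?e u) \<le> (LINT u|lborel. C * cmod (?e u))"
    using C by (intro Bochner_Integration.integral_norm_bound_integral integrable_bounded_mult[OF f C] integrable_mult_right
        integrable_norm complex_gaussian_exp_integral(1)[OF \<alpha>]) (auto simp: norm_mult intro!: mult_right_mono)
  also have "\<dots> = C * (pi / \<alpha> * exp (\<alpha> * (cmod (z + w))\<^sup>2 / 4))"
    unfolding e[symmetric] by (rule integral_mult_right_zero)
  finally have "\<alpha> / pi * cmod (LINT u|lborel. f u * ?e u) \<le> \<alpha> / pi * (C * (pi / \<alpha> * exp (\<alpha> * (cmod (z + w))\<^sup>2 / 4)))"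
    using \<alpha> by (intro mult_left_mono) auto
  also have "\<dots> = C * exp (\<alpha> * (cmod (z + w))\<^sup>2 / 4)" using \<alpha> by simp
  finally show ?thesis
    using \<alpha> by (simp add: toeplitz_fock_kernel[OF f] norm_mult norm_divide)
qed

text \<open>With \<open>w = - z\<close> the exponent \<open>\<alpha> (u cnj w + z cnj u)\<close> is purely imaginary, so that the operator sees
  the Fourier transform of the symbol weighted by a Gaussian.\<close>
lemma fourier_weighted_symbol:
  assumes \<alpha>: "\<alpha> > 0" and f: "f \<in> borel_measurable borel"
  shows "(LINT u|lborel. (f u * exp (- of_real \<alpha> * of_real ((cmod u)\<^sup>2))) * exp (\<xi> * cnj u - cnj \<xi> * u)) =
    of_real (pi / \<alpha>) * toeplitz \<alpha> f (fock_kernel \<alpha> (- \<xi> / of_real \<alpha>)) (\<xi> / of_real \<alpha>)"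
  using \<alpha> by (simp add: toeplitz_fock_kernel[OF f] mult.assoc algebra_simps flip: exp_add)

lemma integrable_weighted_symbol:
  assumes \<alpha>: "\<alpha> > 0" and f: "f \<in> borel_measurable borel" and C: "\<And>u. cmod (f u) \<le> C"
  shows "integrable lborel (\<lambda>u. f u * exp (- of_real \<alpha> * of_real ((cmod u)\<^sup>2)))"
  using \<alpha> by (intro integrable_bounded_mult[OF f C] complex_gaussian_integral(1)) simp

lemma toeplitz_symbol_unique:
  assumes \<alpha>: "\<alpha> > 0" and f: "f \<in> Linfty" "g \<in> Linfty"
    and eq: "\<And>h. h \<in> fock_space \<alpha> \<Longrightarrow> toeplitz \<alpha> f h = toeplitz \<alpha> g h"
  shows "AE u in lebesgue. f u = g u"
proof -
  obtain f' C where f': "f' \<in> borel_measurable borel" "\<And>u. cmod (f' u) \<le> C" "AE u in lebesgue. f u = f' u"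
    "\<And>h. h holomorphic_on UNIV \<Longrightarrow> toeplitz \<alpha> f h = toeplitz \<alpha> f' h"
    using Linfty_borel_representative[OF f(1)] by metis
  obtain g' D where g': "g' \<in> borel_measurable borel" "\<And>u. cmod (g' u) \<le> D" "AE u in lebesgue. g u = g' u"
    "\<And>h. h holomorphic_on UNIV \<Longrightarrow> toeplitz \<alpha> g h = toeplitz \<alpha> g' h"
    using Linfty_borel_representative[OF f(2)] by metis
  define E where "E u = exp (- of_real \<alpha> * of_real ((cmod u)\<^sup>2) :: complex)" for u :: complex
  have int: "integrable lborel (\<lambda>u. f' u * E u)" "integrable lborel (\<lambda>u. g' u * E u)"
    unfolding E_def by (rule integrable_weighted_symbol[OF \<alpha> f'(1,2)] integrable_weighted_symbol[OF \<alpha> g'(1,2)])+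
  have intF: "integrable lborel (\<lambda>u. k u * exp (\<xi> * cnj u - cnj \<xi> * u))" if "integrable lborel k" for k \<xi>
  proof -
    have "cmod (exp (\<xi> * cnj u - cnj \<xi> * u)) \<le> 1" for u by (simp add: algebra_simps)
    from integrable_bounded_mult[OF _ this that] show ?thesis by (simp add: mult.commute)
  qed
  have "AE u in lborel. f' u * E u - g' u * E u = 0"
  proof (rule fourier_zero_imp_AE_zero)
    show "integrable lborel (\<lambda>u. f' u * E u - g' u * E u)" using int by simp
    fix \<xi>
    have "(LINT u|lborel. (f' u * E u) * exp (\<xi> * cnj u - cnj \<xi> * u)) =
        (LINT u|lborel. (g' u * E u) * exp (\<xi> * cnj u - cnj \<xi> * u))"
      unfolding E_def fourier_weighted_symbol[OF \<alpha> f'(1)] fourier_weighted_symbol[OF \<alpha> g'(1)]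
        f'(4)[OF fock_kernel_holomorphic, symmetric] g'(4)[OF fock_kernel_holomorphic, symmetric]
        eq[OF fock_kernel_in_fock_space[OF \<alpha>]] ..
    then show "(LINT u|lborel. (f' u * E u - g' u * E u) * exp (\<xi> * cnj u - cnj \<xi> * u)) = 0"
      unfolding left_diff_distrib
      by (subst Bochner_Integration.integral_diff[OF intF[OF int(1)] intF[OF int(2)]]) simp
  qed
  then have "AE u in lborel. f' u = g' u"
    by eventually_elim (simp add: E_def)
  from AE_completion[OF this] f'(3) g'(3) show ?thesis
    by eventually_elim simp
qed

section \<open>Necessity\<close>

text \<open>For fixed \<open>z\<close> the ratio of the two exponentials is largest where \<open>z + w = 2 \<phi> z\<close>.\<close>
lemma growth_at_optimal_point:
  fixes \<phi> \<psi> :: "complex \<Rightarrow> complex"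
  assumes bound: "\<And>z w. cmod (\<psi> z) * exp (\<alpha> * Re (\<phi> z * cnj w)) \<le> M * exp (\<alpha> * (cmod (z + w))\<^sup>2 / 4)"
  shows "cmod (\<psi> z) * exp (\<alpha> * ((cmod (\<phi> z))\<^sup>2 - Re (\<phi> z * cnj z))) \<le> M"
proof -
  define w where "w = 2 * \<phi> z - z"
  have w1: "(cmod (z + w))\<^sup>2 / 4 = (cmod (\<phi> z))\<^sup>2"
    by (simp add: w_def norm_mult power_mult_distrib)
  have w2: "Re (\<phi> z * cnj w) = 2 * (cmod (\<phi> z))\<^sup>2 - Re (\<phi> z * cnj z)"
    by (simp add: w_def algebra_simps cmod_power2) (simp add: power2_eq_square)
  have "cmod (\<psi> z) * exp (\<alpha> * (2 * (cmod (\<phi> z))\<^sup>2 - Re (\<phi> z * cnj z))) \<le> M * exp (\<alpha> * (cmod (\<phi> z))\<^sup>2)"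
    using bound[of z w] unfolding w2 times_divide_eq_right[symmetric] w1 .
  then have "cmod (\<psi> z) * exp (\<alpha> * (2 * (cmod (\<phi> z))\<^sup>2 - Re (\<phi> z * cnj z))) * exp (- (\<alpha> * (cmod (\<phi> z))\<^sup>2))
      \<le> M * exp (\<alpha> * (cmod (\<phi> z))\<^sup>2) * exp (- (\<alpha> * (cmod (\<phi> z))\<^sup>2))"
    by (rule mult_right_mono) simp
  then show ?thesis
    unfolding mult.assoc exp_add[symmetric] by (simp add: algebra_simps)
qed

lemma gaussian_concentration_tendsto_0:
  fixes g :: "complex \<Rightarrow> complex"
  assumes g: "integrable lborel g"
  shows "(\<lambda>n. LINT u|lborel. g u * of_real (exp (- (cmod (u - a))\<^sup>2 / (1 / real (Suc n))))) \<longlonglongrightarrow> 0"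
proof -
  have [measurable]: "g \<in> borel_measurable borel" using g by auto
  have "(\<lambda>n. LINT u|lborel. g u * of_real (exp (- (cmod (u - a))\<^sup>2 / (1 / real (Suc n))))) \<longlonglongrightarrow> (LINT u::complex|lborel. (0::complex))"
  proof (rule integral_dominated_convergence[where w = "\<lambda>u. cmod (g u)"])
    have "(\<lambda>n. g u * of_real (exp (- (cmod (u - a))\<^sup>2 / (1 / real (Suc n))))) \<longlonglongrightarrow> 0" if "u \<noteq> a" for u
    proof -
      have "(\<lambda>n. exp (- (cmod (u - a))\<^sup>2) ^ Suc n) \<longlonglongrightarrow> 0"
        using that by (intro LIMSEQ_Suc LIMSEQ_power_zero) simp
      moreover have "exp (- (cmod (u - a))\<^sup>2) ^ Suc n = exp (- (cmod (u - a))\<^sup>2 / (1 / real (Suc n)))" for n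
        unfolding exp_of_nat_mult[symmetric] by (simp add: mult.commute)
      ultimately have "(\<lambda>n. exp (- (cmod (u - a))\<^sup>2 / (1 / real (Suc n)))) \<longlonglongrightarrow> 0"
        by (simp only:)
      from tendsto_mult[OF tendsto_const tendsto_of_real[OF this], of "g u"]
      show ?thesis by simp
    qed
    then show "AE u in lborel. (\<lambda>n. g u * of_real (exp (- (cmod (u - a))\<^sup>2 / (1 / real (Suc n))))) \<longlonglongrightarrow> 0"
      using AE_lborel_singleton[of a] by (auto elim!: eventually_mono)
    show "AE u in lborel. cmod (g u * of_real (exp (- (cmod (u - a))\<^sup>2 / (1 / real (Suc n))))) \<le> cmod (g u)" for n
      by (auto simp: norm_mult intro!: mult_left_le)
  qed (use g in auto)
  then show ?thesis by simp
qed

text \<open>The operator \<open>h \<mapsto> h a \<psi>\<close> would need a point mass at \<open>a\<close> as its symbol.  Quantitatively: the growth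
  bound makes \<open>\<psi> z exp (- \<alpha> cnj a z)\<close> a constant \<open>c\<close>, the Fourier transform of the weighted symbol
  \<open>g\<close> is then that of a multiple of the point mass, and the integrals of \<open>g\<close> against Gaussians
  of height one centred at \<open>a\<close> all equal \<open>(pi / \<alpha>) c\<close> while they must tend to zero.\<close>
lemma constant_composition_imp_zero:
  fixes \<psi> f :: "complex \<Rightarrow> complex"
  assumes \<alpha>: "\<alpha> > 0" and \<psi>: "\<psi> holomorphic_on UNIV"
    and f: "f \<in> borel_measurable borel" and C: "\<And>u. cmod (f u) \<le> C"
    and eq: "\<And>z w. \<psi> z * exp (of_real \<alpha> * a * cnj w) = toeplitz \<alpha> f (fock_kernel \<alpha> w) z"
  shows "\<psi> z = 0"
proof -
  define H where "H z = \<psi> z * exp (- of_real \<alpha> * cnj a * z)" for z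
  have bound: "cmod (\<psi> z) * exp (\<alpha> * Re (a * cnj w)) \<le> C * exp (\<alpha> * (cmod (z + w))\<^sup>2 / 4)" for z w
    using toeplitz_fock_kernel_bound[OF \<alpha> f C, of w z] unfolding eq[symmetric]
    by (simp add: norm_mult mult.assoc)
  have "cmod (H z) \<le> C * exp (- (\<alpha> * (cmod a)\<^sup>2))" for z
  proof -
    have "cmod (\<psi> z) * exp (\<alpha> * ((cmod a)\<^sup>2 - Re (a * cnj z))) \<le> C"
      using growth_at_optimal_point[where \<phi> = "\<lambda>_. a", OF bound] .
    then have "cmod (\<psi> z) * exp (\<alpha> * ((cmod a)\<^sup>2 - Re (a * cnj z))) * exp (- (\<alpha> * (cmod a)\<^sup>2))
        \<le> C * exp (- (\<alpha> * (cmod a)\<^sup>2))"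
      by (rule mult_right_mono) simp
    then show ?thesis
      unfolding mult.assoc exp_add[symmetric] by (simp add: H_def norm_mult algebra_simps)
  qed
  then have "bounded (range H)" by (auto simp: bounded_iff)
  moreover have "H holomorphic_on UNIV" unfolding H_def by (intro holomorphic_intros \<psi>)
  ultimately obtain c where c: "\<And>z. H z = c"
    using Liouville_theorem[of H] by (auto simp: constant_on_def)
  then have \<psi>c: "\<psi> z = c * exp (of_real \<alpha> * cnj a * z)" for z
    using c[of z] by (auto simp: H_def exp_minus field_simps)
  define g where "g u = f u * exp (- of_real \<alpha> * of_real ((cmod u)\<^sup>2))" for u
  have g: "integrable lborel g"
    unfolding g_def by (rule integrable_weighted_symbol[OF \<alpha> f C])
  have hat: "(LINT u|lborel. g u * exp (\<xi> * cnj u - cnj \<xi> * u)) =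
      of_real (pi / \<alpha>) * c * exp (cnj a * \<xi> - a * cnj \<xi>)" for \<xi>
    unfolding g_def fourier_weighted_symbol[OF \<alpha> f] eq[symmetric] \<psi>c
    using \<alpha> by (simp add: mult.assoc algebra_simps flip: exp_add)
  have mean: "(LINT u|lborel. g u * of_real (exp (- (cmod (u - a))\<^sup>2 / t))) = of_real (pi / \<alpha>) * c" if t: "t > 0" for t
  proof -
    have "of_real (pi / t) * (LINT u|lborel. g u * of_real (exp (- (cmod (u - a))\<^sup>2 / t))) =
        (LINT \<xi>|lborel. of_real (pi / \<alpha>) * c * exp (- of_real t * of_real ((cmod \<xi>)\<^sup>2)))"
      unfolding fourier_gaussian_pairing[OF g t, symmetric] hat mult.assoc exp_add[symmetric]
      by (simp add: algebra_simps)
    also have "\<dots> = of_real (pi / \<alpha>) * c * (LINT \<xi>::complex|lborel. exp (- of_real t * of_real ((cmod \<xi>)\<^sup>2)))"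
      by (rule integral_mult_right_zero)
    also have "(LINT \<xi>::complex|lborel. exp (- of_real t * of_real ((cmod \<xi>)\<^sup>2))) = complex_of_real (pi / t)"
      using complex_gaussian_integral(2)[of "of_real t"] t by simp
    finally show ?thesis using t \<alpha> by (simp add: field_simps)
  qed
  have "(LINT u|lborel. g u * of_real (exp (- (cmod (u - a))\<^sup>2 / (1 / real (Suc n))))) = of_real (pi / \<alpha>) * c" for n
    by (rule mean) simp
  then have "(\<lambda>n::nat. of_real (pi / \<alpha>) * c) \<longlonglongrightarrow> 0"
    using gaussian_concentration_tendsto_0[OF g, of a] by (simp only:)
  then have "c = 0" using \<alpha> by (simp add: LIMSEQ_const_iff)
  then show ?thesis by (simp add: \<psi>c)
qed

lemma affine_growth_cond_if_eq_toeplitz: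
  assumes \<alpha>: "\<alpha> > 0" and hol: "\<psi> holomorphic_on UNIV" "\<phi> holomorphic_on UNIV"
    and f: "f \<in> Linfty" and eq: "weighted_comp_eq_toeplitz \<alpha> \<psi> \<phi> f" and nz: "\<psi> z0 \<noteq> 0"
  shows "\<exists>a \<mu>. affine_growth_cond \<alpha> \<psi> \<phi> a \<mu>"
proof -
  obtain g C where g: "g \<in> borel_measurable borel" and C: "\<And>u. cmod (g u) \<le> C"
    and fg: "\<And>h. h holomorphic_on UNIV \<Longrightarrow> toeplitz \<alpha> f h = toeplitz \<alpha> g h"
    using Linfty_borel_representative[OF f] by metis
  have ker: "\<psi> z * exp (of_real \<alpha> * \<phi> z * cnj w) = toeplitz \<alpha> g (fock_kernel \<alpha> w) z" for z w
  proof -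
    have "weighted_comp \<psi> \<phi> (fock_kernel \<alpha> w) = toeplitz \<alpha> f (fock_kernel \<alpha> w)"
      using eq fock_kernel_in_fock_space[OF \<alpha>] by (simp add: weighted_comp_eq_toeplitz_def)
    then show ?thesis
      unfolding fg[OF fock_kernel_holomorphic]
      by (simp add: weighted_comp_def fock_kernel_def fun_eq_iff)
  qed
  have bound: "cmod (\<psi> z) * exp (\<alpha> * Re (\<phi> z * cnj w)) \<le> C * exp (\<alpha> * (cmod (z + w))\<^sup>2 / 4)" for z w
    using toeplitz_fock_kernel_bound[OF \<alpha> g C, of w z] unfolding ker[symmetric]
    by (simp add: norm_mult mult.assoc)
  obtain a \<mu> where \<phi>: "\<And>z. \<phi> z = a + \<mu> * z" and \<mu>: "(cmod \<mu>)\<^sup>2 \<le> Re \<mu>"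
    using exponent_bound_imp_affine[OF hol \<alpha> bound nz] by blast
  have "\<mu> \<noteq> 0"
  proof
    assume "\<mu> = 0"
    then have "\<psi> z * exp (of_real \<alpha> * a * cnj w) = toeplitz \<alpha> g (fock_kernel \<alpha> w) z" for z w
      using ker[of z w] by (simp add: \<phi>)
    from constant_composition_imp_zero[OF \<alpha> hol(1) g C this, of z0] nz show False by simp
  qed
  moreover have "cmod (\<psi> z) * exp (\<alpha> * (- (Re \<mu> - (cmod \<mu>)\<^sup>2) * (cmod z)\<^sup>2 + Re ((2 * \<mu> - 1) * cnj a * z)))
      \<le> C * exp (- (\<alpha> * (cmod a)\<^sup>2))" for z
  proof -
    have e: "(cmod (\<phi> z))\<^sup>2 - Re (\<phi> z * cnj z) =
        - (Re \<mu> - (cmod \<mu>)\<^sup>2) * (cmod z)\<^sup>2 + Re ((2 * \<mu> - 1) * cnj a * z) + (cmod a)\<^sup>2"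
      unfolding \<phi> cmod_power2 by (simp add: algebra_simps power2_eq_square)
    have "cmod (\<psi> z) * exp (\<alpha> * ((cmod (\<phi> z))\<^sup>2 - Re (\<phi> z * cnj z))) * exp (- (\<alpha> * (cmod a)\<^sup>2)) \<le> C * exp (- (\<alpha> * (cmod a)\<^sup>2))"
      by (intro mult_right_mono growth_at_optimal_point bound) simp
    moreover have "\<alpha> * (x + y) + - (\<alpha> * y) = \<alpha> * x" for x y by (simp add: algebra_simps)
    ultimately show ?thesis
      unfolding e mult.assoc exp_add[symmetric] by simp
  qed
  then have "bdd_above (range (\<lambda>z. cmod (\<psi> z) *
      exp (\<alpha> * (- (Re \<mu> - (cmod \<mu>)\<^sup>2) * (cmod z)\<^sup>2 + Re ((2 * \<mu> - 1) * cnj a * z)))))"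
    by (rule bdd_aboveI2)
  ultimately have "affine_growth_cond \<alpha> \<psi> \<phi> a \<mu>"
    using \<phi> \<mu> by (simp only: affine_growth_cond_def) simp
  then show ?thesis by blast
qed

section \<open>Sufficiency and uniqueness\<close>

text \<open>A product of two square integrable functions, once the Gaussian weight is split evenly between
  them.\<close>
lemma integrable_fock_times_kernel:
  assumes \<alpha>: "\<alpha> > 0" and h: "h \<in> fock_space \<alpha>"
  shows "integrable lborel (\<lambda>u. h u * exp (of_real \<alpha> * z * cnj u - of_real \<alpha> * of_real ((cmod u)\<^sup>2)))"
proof -
  have hol: "h holomorphic_on UNIV" and int: "integrable lborel (\<lambda>z. (cmod (h z))\<^sup>2 * exp (- \<alpha> * (cmod z)\<^sup>2))"
    using h by (auto simp: fock_space_iff[OF \<alpha>])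
  have [measurable]: "h \<in> borel_measurable borel" using hol by (rule borel_measurable_entire)
  let ?k = "\<lambda>u. cmod (exp (0 * u + 2 * of_real \<alpha> * z * cnj u - of_real \<alpha> * of_real ((cmod u)\<^sup>2)))"
  have "integrable lborel (\<lambda>u. (cmod (h u))\<^sup>2 * exp (- \<alpha> * (cmod u)\<^sup>2) + ?k u)"
    by (intro Bochner_Integration.integrable_add int integrable_norm complex_gaussian_exp_integral(1) \<alpha>)
  then show ?thesis
  proof (rule Bochner_Integration.integrable_bound)
    have "cmod (h u * exp (of_real \<alpha> * z * cnj u - of_real \<alpha> * of_real ((cmod u)\<^sup>2))) \<le>
        (cmod (h u))\<^sup>2 * exp (- \<alpha> * (cmod u)\<^sup>2) + ?k u" for u
    proof -
      define x y where "x = cmod (h u) * exp (- \<alpha> * (cmod u)\<^sup>2 / 2)"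
        and "y = exp (\<alpha> * Re (z * cnj u) - \<alpha> * (cmod u)\<^sup>2 / 2)"
      have "cmod (h u * exp (of_real \<alpha> * z * cnj u - of_real \<alpha> * of_real ((cmod u)\<^sup>2))) = x * y"
        by (simp add: x_def y_def norm_mult mult.assoc algebra_simps flip: exp_add of_real_power)
      moreover have "x\<^sup>2 = (cmod (h u))\<^sup>2 * exp (- \<alpha> * (cmod u)\<^sup>2)"
        by (simp add: x_def power_mult_distrib flip: exp_double)
      moreover have "y\<^sup>2 = ?k u"
        by (simp add: y_def mult.assoc algebra_simps flip: exp_double of_real_power)
      moreover have "0 \<le> x * y" by (simp add: x_def y_def)
      then have "x * y \<le> x\<^sup>2 + y\<^sup>2"
        using sum_squares_bound[of x y] by linarith
      ultimately show ?thesis by simp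
    qed
    then show "AE u in lborel. cmod (h u * exp (of_real \<alpha> * z * cnj u - of_real \<alpha> * of_real ((cmod u)\<^sup>2))) \<le>
        norm ((cmod (h u))\<^sup>2 * exp (- \<alpha> * (cmod u)\<^sup>2) + ?k u)"
      by (intro AE_I2) (smt (verit) real_norm_def)
    show "(\<lambda>u. h u * exp (of_real \<alpha> * z * cnj u - of_real \<alpha> * of_real ((cmod u)\<^sup>2))) \<in> borel_measurable lborel"
      by simp
  qed
qed

text \<open>In the variable \<open>v = (w - a) / \<mu>\<close> the exponent of the symbol factors.  Both the boundedness of the
  symbol and the evaluation of its Toeplitz operator become transparent in this form.\<close>
lemma toeplitz_symbol_affine_arg:
  assumes "\<mu> \<noteq> 0"
  shows "toeplitz_symbol \<alpha> \<psi> a \<mu> (a + \<mu> * v) =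
    1 / \<mu> * exp (of_real \<alpha> * (cnj (a + \<mu> * v) * (a + \<mu> * v - v))) * \<psi> v"
proof -
  have "(\<mu> - 1) / \<mu> * of_real ((cmod (a + \<mu> * v))\<^sup>2) + a / \<mu> * cnj (a + \<mu> * v) =
      cnj (a + \<mu> * v) * (a + \<mu> * v - v)"
  proof -
    have "(\<mu> - 1) / \<mu> * (w * w') + a / \<mu> * w' = w' * (w - (w - a) / \<mu>)" for w w'
      using assms by (simp add: field_simps)
    then show ?thesis
      unfolding complex_norm_square using assms by simp
  qed
  then show ?thesis using assms by (simp add: toeplitz_symbol_def)
qed

lemma toeplitz_symbol_bounded:
  assumes cond: "affine_growth_cond \<alpha> \<psi> \<phi> a \<mu>"
  shows "\<exists>C. \<forall>w. cmod (toeplitz_symbol \<alpha> \<psi> a \<mu> w) \<le> C"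
proof -
  have \<mu>: "\<mu> \<noteq> 0" using cond by (simp add: affine_growth_cond_def)
  let ?E = "\<lambda>v. - (Re \<mu> - (cmod \<mu>)\<^sup>2) * (cmod v)\<^sup>2 + Re ((2 * \<mu> - 1) * cnj a * v)"
  obtain B where B: "\<And>v. cmod (\<psi> v) * exp (\<alpha> * ?E v) \<le> B"
    using cond by (auto simp: affine_growth_cond_def bdd_above_def)
  have "cmod (toeplitz_symbol \<alpha> \<psi> a \<mu> w) \<le> B * exp (\<alpha> * (cmod a)\<^sup>2) / cmod \<mu>" for w
  proof -
    define v where "v = (w - a) / \<mu>"
    have w: "w = a + \<mu> * v" using \<mu> by (simp add: v_def)
    have "Re (cnj (a + \<mu> * v) * (a + \<mu> * v - v)) = ?E v + (cmod a)\<^sup>2"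
      unfolding cmod_power2 by (simp add: algebra_simps power2_eq_square)
    then have "Re (of_real \<alpha> * (cnj (a + \<mu> * v) * (a + \<mu> * v - v))) = \<alpha> * (?E v + (cmod a)\<^sup>2)"
      by (simp only: Re_complex_of_real times_complex.sel Im_complex_of_real)
    then have "cmod (toeplitz_symbol \<alpha> \<psi> a \<mu> w) = cmod (\<psi> v) * exp (\<alpha> * (?E v + (cmod a)\<^sup>2)) / cmod \<mu>"
      unfolding w toeplitz_symbol_affine_arg[OF \<mu>] norm_mult norm_divide norm_exp_eq_Re
      by simp
    also have "\<dots> = cmod (\<psi> v) * exp (\<alpha> * ?E v) * exp (\<alpha> * (cmod a)\<^sup>2) / cmod \<mu>"
      by (simp only: distrib_left exp_add mult.assoc)
    also have "\<dots> \<le> B * exp (\<alpha> * (cmod a)\<^sup>2) / cmod \<mu>"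
      by (intro divide_right_mono mult_right_mono B) auto
    finally show ?thesis .
  qed
  then show ?thesis by blast
qed

lemma borel_measurable_toeplitz_symbol:
  assumes "\<psi> holomorphic_on UNIV"
  shows "toeplitz_symbol \<alpha> \<psi> a \<mu> \<in> borel_measurable borel"
proof -
  have [measurable]: "\<psi> \<in> borel_measurable borel" using assms by (rule borel_measurable_entire)
  show ?thesis unfolding toeplitz_symbol_def[abs_def] by measurable
qed

text \<open>The substitution \<open>u = b + \<mu> \<zeta>\<close> with \<open>b = a + \<mu> z = \<phi> z\<close> cancels every term of the exponent except
  \<open>- \<alpha> cnj b \<zeta>\<close>, which is holomorphic, and \<open>- \<alpha> cnj \<mu> \<bar>\<zeta>\<bar>\<^sup>2\<close>, which is radial.  The mean value
  property evaluates the integral, and the Jacobian \<open>\<bar>\<mu>\<bar>\<^sup>2\<close> combines with \<open>1 / \<mu>\<close> and the Gaussian integral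
  \<open>pi / (\<alpha> cnj \<mu>)\<close> to cancel the normalising constant of the operator.\<close>
lemma toeplitz_symbol_eq_weighted_comp:
  assumes \<alpha>: "\<alpha> > 0" and \<psi>: "\<psi> holomorphic_on UNIV" and cond: "affine_growth_cond \<alpha> \<psi> \<phi> a \<mu>"
  shows "weighted_comp_eq_toeplitz \<alpha> \<psi> \<phi> (toeplitz_symbol \<alpha> \<psi> a \<mu>)"
  unfolding weighted_comp_eq_toeplitz_def
proof (intro ballI ext)
  fix h z assume h: "h \<in> fock_space \<alpha>"
  have \<mu>: "\<mu> \<noteq> 0" and \<phi>: "\<phi> z = a + \<mu> * z" and Re: "(cmod \<mu>)\<^sup>2 \<le> Re \<mu>"
    using cond by (auto simp: affine_growth_cond_def)
  have "Re \<mu> > 0" using Re \<mu> by (smt (verit) zero_less_norm_iff zero_less_power)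
  then have Re\<mu>: "Re (of_real \<alpha> * cnj \<mu>) > 0" using \<alpha> by simp
  have hol: "h holomorphic_on UNIV" using h by (simp add: fock_space_def)
  let ?F = "toeplitz_symbol \<alpha> \<psi> a \<mu>"
  have F: "?F \<in> borel_measurable borel" using \<psi> by (rule borel_measurable_toeplitz_symbol)
  obtain C where C: "\<And>w. cmod (?F w) \<le> C" using toeplitz_symbol_bounded[OF cond] by blast
  let ?I = "\<lambda>u. ?F u * (h u * exp (of_real \<alpha> * z * cnj u - of_real \<alpha> * of_real ((cmod u)\<^sup>2)))"
  have int: "integrable lborel ?I"
    by (intro integrable_bounded_mult[OF F C] integrable_fock_times_kernel \<alpha> h)
  define b where "b = a + \<mu> * z"
  define G where "G \<zeta> = \<psi> (z + \<zeta>) * h (b + \<mu> * \<zeta>) * exp (- of_real \<alpha> * cnj b * \<zeta>)" for \<zeta>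
  define k where "k \<zeta> = exp (- (of_real \<alpha> * cnj \<mu>) * of_real ((cmod \<zeta>)\<^sup>2))" for \<zeta>
  have I: "?I (b + \<mu> * \<zeta>) = 1 / \<mu> * (G \<zeta> * k \<zeta>)" for \<zeta>
  proof -
    have b: "b + \<mu> * \<zeta> = a + \<mu> * (z + \<zeta>)" by (simp add: b_def algebra_simps)
    define W where "W = b + \<mu> * \<zeta>"
    have "?F W = 1 / \<mu> * exp (of_real \<alpha> * (cnj W * (W - (z + \<zeta>)))) * \<psi> (z + \<zeta>)"
      unfolding W_def b by (rule toeplitz_symbol_affine_arg[OF \<mu>])
    moreover have "exp (of_real \<alpha> * (cnj W * (W - (z + \<zeta>)))) * exp (of_real \<alpha> * z * cnj W - of_real \<alpha> * of_real ((cmod W)\<^sup>2)) =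
        exp (- of_real \<alpha> * cnj b * \<zeta>) * k \<zeta>"
      unfolding k_def exp_add[symmetric] complex_norm_square W_def by (simp add: algebra_simps)
    ultimately show ?thesis
      unfolding G_def W_def[symmetric] by (simp add: mult_ac)
  qed
  have "integrable lborel (\<lambda>\<zeta>. \<mu> * ?I (b + \<mu> * \<zeta>))"
    by (intro integrable_mult_right iffD2[OF lborel_complex_integrable_affine_iff[OF \<mu>, where f = "?I" and a = b] int])
  then have intG: "integrable lborel (\<lambda>\<zeta>. G \<zeta> * k \<zeta>)"
    unfolding I using \<mu> by simp
  have shift: "(\<lambda>\<zeta>. p (c + d * \<zeta>)) holomorphic_on UNIV" if "p holomorphic_on UNIV" for p :: "complex \<Rightarrow> complex" and c d
    by (rule holomorphic_on_compose_gen[OF _ that, of "\<lambda>\<zeta>. c + d * \<zeta>", unfolded o_def])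
       (auto intro!: holomorphic_intros)
  have "G holomorphic_on UNIV"
    unfolding G_def using shift[OF \<psi>, of z 1] shift[OF hol, of b \<mu>] by (intro holomorphic_intros) simp_all
  then have "(LINT \<zeta>|lborel. G \<zeta> * k \<zeta>) = G 0 * (LINT \<zeta>|lborel. k \<zeta>)"
    by (rule integral_entire_mult_radial[OF _ _ _ intG]) (auto simp: k_def norm_mult)
  also have "(LINT \<zeta>|lborel. k \<zeta>) = of_real pi / (of_real \<alpha> * cnj \<mu>)"
    unfolding k_def by (rule complex_gaussian_integral(2)[OF Re\<mu>])
  finally have GK: "(LINT \<zeta>|lborel. G \<zeta> * k \<zeta>) = G 0 * (of_real pi / (of_real \<alpha> * cnj \<mu>))" .
  have "toeplitz \<alpha> ?F h z = of_real (\<alpha> / pi) * (LINT u|lborel. ?I u)"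
    by (simp only: toeplitz_lborel[OF F hol] mult.assoc)
  also have "(LINT u|lborel. ?I u) = (cmod \<mu>)\<^sup>2 *\<^sub>R (LINT \<zeta>|lborel. ?I (b + \<mu> * \<zeta>))"
    by (rule lborel_complex_integral_affine[OF \<mu>])
  also have "(LINT \<zeta>|lborel. ?I (b + \<mu> * \<zeta>)) = 1 / \<mu> * (LINT \<zeta>|lborel. G \<zeta> * k \<zeta>)"
    unfolding I by (rule integral_mult_right_zero)
  also have "of_real (\<alpha> / pi) * ((cmod \<mu>)\<^sup>2 *\<^sub>R (1 / \<mu> * (LINT \<zeta>|lborel. G \<zeta> * k \<zeta>))) = G 0"
    unfolding GK scaleR_conv_of_real complex_norm_square using \<mu> \<alpha> by (simp add: field_simps)
  also have "G 0 = weighted_comp \<psi> \<phi> h z"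
    by (simp add: G_def b_def weighted_comp_def \<phi>)
  finally show "weighted_comp \<psi> \<phi> h z = toeplitz \<alpha> ?F h z" by simp
qed

theorem theorem1p2:
  fixes \<alpha> :: real and \<psi> \<phi> :: "complex \<Rightarrow> complex"
  assumes "\<alpha> > 0" and "\<psi> holomorphic_on UNIV" and "\<phi> holomorphic_on UNIV"
  shows "((\<exists>f \<in> Linfty. weighted_comp_eq_toeplitz \<alpha> \<psi> \<phi> f) \<longleftrightarrow>
            ((\<forall>z. \<psi> z = 0) \<or> (\<exists>a \<mu>. affine_growth_cond \<alpha> \<psi> \<phi> a \<mu>))) \<and>
         (\<not> (\<forall>z. \<psi> z = 0) \<longrightarrow>
            (\<forall>a \<mu>. affine_growth_cond \<alpha> \<psi> \<phi> a \<mu> \<longrightarrow>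
               toeplitz_symbol \<alpha> \<psi> a \<mu> \<in> Linfty \<and>
               weighted_comp_eq_toeplitz \<alpha> \<psi> \<phi> (toeplitz_symbol \<alpha> \<psi> a \<mu>) \<and>
               (\<forall>f \<in> Linfty. weighted_comp_eq_toeplitz \<alpha> \<psi> \<phi> f \<longrightarrow>
                  (AE w in lebesgue. f w = toeplitz_symbol \<alpha> \<psi> a \<mu> w))))"
proof -
  have sym: "toeplitz_symbol \<alpha> \<psi> a \<mu> \<in> Linfty"
    "weighted_comp_eq_toeplitz \<alpha> \<psi> \<phi> (toeplitz_symbol \<alpha> \<psi> a \<mu>)" if "affine_growth_cond \<alpha> \<psi> \<phi> a \<mu>" for a \<mu>
    using toeplitz_symbol_bounded[OF that] bounded_borel_in_Linfty borel_measurable_toeplitz_symbol[OF assms(2)]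
      toeplitz_symbol_eq_weighted_comp[OF assms(1,2) that] by blast+
  have zero: "\<exists>f \<in> Linfty. weighted_comp_eq_toeplitz \<alpha> \<psi> \<phi> f" if "\<forall>z. \<psi> z = 0"
  proof
    show "(\<lambda>_. 0) \<in> Linfty" by (rule bounded_borel_in_Linfty[of _ 0]) auto
    show "weighted_comp_eq_toeplitz \<alpha> \<psi> \<phi> (\<lambda>_. 0)"
      using that by (simp add: weighted_comp_eq_toeplitz_def weighted_comp_def toeplitz_def fun_eq_iff)
  qed
  have uniq: "AE w in lebesgue. f w = toeplitz_symbol \<alpha> \<psi> a \<mu> w"
    if "affine_growth_cond \<alpha> \<psi> \<phi> a \<mu>" "f \<in> Linfty" "weighted_comp_eq_toeplitz \<alpha> \<psi> \<phi> f" for a \<mu> f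
    using that(3) sym(2)[OF that(1)]
    by (intro toeplitz_symbol_unique[OF assms(1) that(2) sym(1)[OF that(1)]])
       (simp add: weighted_comp_eq_toeplitz_def)
  show ?thesis
    using sym zero uniq affine_growth_cond_if_eq_toeplitz[OF assms] by blast
qed

end
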